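(* Let $\phi_1,\dots,\phi_n\in\mathcal V_h$ be level-set functions and let $F$ be any one of the $2^n$ subdomains of $D$ that they define. Let $i\ne k$ be indices in $\{1,\dots,n\}$, let $w$ be a linear Lagrangian basis function of $\mathcal V_h$, and let $\phi_{k,t}(\boldsymbol x)=\phi_k(\boldsymbol x)+t\,w(\boldsymbol x)$. Suppose that the following intersection condition holds: for a subfacet of dimension $d-2$ (a point for $d=2$, an edge for $d=3$), $\partial D_{\phi_k}$ intersects at most one other $\partial D_{\phi_j}$ along the subfacet, and any intersection does not occur on the boundary $\partial K$ of a cell. Let $g\in C^0(\overline{\mathcal T}_h)$ and $$J(\phi_k)=\int_{\partial D_{\phi_i}\cap F_i} g\,\mathrm dS ,$$ where $J(\phi_{k,t})$ denotes the same integral with $\phi_k$ replaced by $\phi_{k,t}$ in the definition of $F_i$ (all other level-set functions being fixed). If $D_{\phi_k}\in\mathcal D_p$, then the directional semiderivative of $J$ satisfies $$\mathrm dJ(\phi_k)(w)=\lim_{t\to0^+}\frac1t\bigl(J(\phi_{k,t})-J(\phi_k)\bigr)=\int_{\partial D_{\phi_i}\cap\partial D_{\phi_k}\cap F_{ik}} g\,\frac{w}{|\partial_{\boldsymbol N^i}\phi_k|}\,\mathrm d\gamma,$$ where $\boldsymbol N^i$ is the unit normal to $\partial D_{\phi_k}$ inside $\partial D_{\phi_i}$, outward with respect to $D_{\phi_k}$. If $D_{\phi_k}\in\mathcal D_c$, the right-hand side is of opposite sign. (i) If $\partial D_{\phi_k}$ intersects some mesh point (vertex) of $\mathcal T_h$,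 then $g$ and $\partial_{\boldsymbol N^i}\phi_k$ in the formula are the limits of these functions from the interior of $\partial D_{\phi_i}\cap F_i$, whenever these quantities possess jump discontinuities on $\partial D_{\phi_i}\cap\partial D_{\phi_k}\cap F_{ik}$. (ii) If $\partial D_{\phi_k}$ does not intersect any mesh point of $\mathcal T_h$, the semiderivatives for $t\to0^-$ and $t\to0^+$ agree.
   Context: Setting. $D\subset\mathbb R^d$ is a hold-all background domain partitioned by a mesh $\mathcal T_h$ of simplices (cells) $K$. $\mathcal V_h=\{v\in C^0(\mathcal T_h): v|_K\in\mathbb P_1(K)\ \forall K\in\mathcal T_h\}$ is the space of continuous, cellwise affine functions; its linear Lagrangian basis functions are the nodal hat functions (so $w\ge 0$). $C^m(\overline{\mathcal T}_h)$ denotes the functions $g$ with $g|_K\in C^m(\overline K)$ for each $K\in\mathcal T_h$ (jumps between cells are allowed). Level-set domains. For $\phi\in\mathcal V_h$: $D_\phi=\{\boldsymbol x\in D:\phi(\boldsymbol x)<0\}$, $\partial D_\phi=\{\boldsymbol x\in D:\phi(\boldsymbol x)=0\}$, and $\overline D_\phi^{\complement}=D\setminus\overline D_\phi=\{\boldsymbol x\in D:\phi(\boldsymbol x)>0\}$. Write $D_{\phi_k,t}=D_{\phi_{k,t}}$. Subdomains. Given $\phi_1,\dots,\phi_n$, the $2^n$ subdomains are all the sets $A_1\cap\dots\cap A_n$ with each $A_j$ equal to either $D_{\phi_j}$ or $\overline D_{\phi_j}^{\complement}$. For $F=A_1\cap\dots\cap A_n$ one of these: $F_i$ is the intersection with the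 factor $A_i$ removed, and $F_{ik}$ is the intersection with both factors $A_i$ and $A_k$ removed (equal to $D$ if no factors remain). $\mathcal D=\{D_{\phi_1},\dots,D_{\phi_n}\}$ is split into $\mathcal D_p$ (those $D_{\phi_j}$ with $A_j=D_{\phi_j}$) and $\mathcal D_c$ (those with $A_j=\overline D_{\phi_j}^{\complement}$). Standing assumption on the smallness of perturbations. There is $t_{\max}>0$ such that, for each cell $K$ in the support of $w$ and the convex polytope $\mathcal P=F_{ik}\cap K$, with $H_t^{\pm}$ the two halfspaces generated by the plane $\Pi_t$ satisfying $\Pi_t|_K=\{\boldsymbol x\in K:\phi_{k,t}(\boldsymbol x)=0\}$ ($H^-_t$ on the side $\phi_{k,t}<0$) and $H^\pm=H_0^\pm$, the geometric elements (facets, edges and vertices for $d=3$) of $H^\pm\cap\mathcal P$ are topologically equivalent to those of $H_t^\pm\cap\mathcal P$ for all $t\in(0,t_{\max}]$. Conormals. Extrinsically, if $\boldsymbol n_k$ and $\boldsymbol n_i$ are unit normals of $\partial D_{\phi_k}$ and $\partial D_{\phi_i}$, then $\boldsymbol N^i=\pm\tilde{\boldsymbol N}/\|\tilde{\boldsymbol N}\|$ with $\tilde{\boldsymbol N}=\boldsymbol n_k-(\boldsymbol n_k\cdot\boldsymbol n_i)\boldsymbol n_i$, the sign chosen so that $\boldsymbol N^i$ points out of $D_{\phi_k}$. $\partial_{\boldsymbol v}\phi=\boldsymbol v\cdot\nabla\phi$ is computed cellwise. $\mathrm dS$ is $(d-1)$-dimensional measure and $\mathrm d\gamma$ is $(d-2)$-dimensional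 measure; for $d=2$ the integral with respect to $\mathrm d\gamma$ is evaluated pointwise, as the sum of the point values over the intersection points.
   Formalization: The two signs are interchanged: the right-hand side carries a minus sign if D_{φ_k} is in D_p and a plus sign if it is in D_c, since adding t·w with w ≥ 0 shrinks {φ_k < 0}; the signs as stated fail already for g = 1 on a single triangle. *)

theory Defs
  imports "HOL-Analysis.Analysis"
begin

section \<open>Simplicial meshes and finite element spaces\<close>

text \<open>
  The hold-all domain \<open>D\<close> is the closed polyhedral set covered by the (closed) cells, so that
  the boundary of \<open>D\<close> is part of the union of the cell boundaries.
\<close>

definition mesh :: "'a::euclidean_space set \<Rightarrow> 'a set set \<Rightarrow> bool" where
  "mesh D T \<longleftrightarrow>
     triangulation T \<and> T \<noteq> {} \<and> (\<forall>K\<in>T. aff_dim K = int DIM('a)) \<and> \<Union>T = D"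

definition mesh_points :: "'a::euclidean_space set set \<Rightarrow> 'a set" where
  "mesh_points T = {p. \<exists>K\<in>T. p extreme_point_of K}"

definition cell_interiors :: "'a::euclidean_space set set \<Rightarrow> 'a set" where
  "cell_interiors T = (\<Union>K\<in>T. interior K)"

definition V_h :: "'a::euclidean_space set set \<Rightarrow> ('a \<Rightarrow> real) set" where
  "V_h T = {v. continuous_on (\<Union>T) v \<and> (\<forall>K\<in>T. \<exists>a b. \<forall>x\<in>K. v x = a \<bullet> x + b)}"

definition lagrange_basis :: "'a::euclidean_space set set \<Rightarrow> ('a \<Rightarrow> real) set" where
  "lagrange_basis T =
     {w \<in> V_h T. \<exists>p\<in>mesh_points T. w p = 1 \<and> (\<forall>q\<in>mesh_points T - {p}. w q = 0)}"

text \<open>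
  The space of functions whose restriction to each cell is continuous up to the boundary of
  the cell. Such a function may jump across cell boundaries, and what value it has on a cell
  boundary is a matter of representation; any bounded Borel choice is allowed there.
\<close>

definition broken_C0 :: "'a::euclidean_space set set \<Rightarrow> ('a \<Rightarrow> real) set" where
  "broken_C0 T =
     {g. (\<forall>K\<in>T. \<exists>h. continuous_on K h \<and> (\<forall>x\<in>interior K. g x = h x)) \<and>
         set_borel_measurable borel (\<Union>T) g \<and> bounded (g ` \<Union>T)}"


section \<open>Level-set domains and the subdomains they define\<close>

definition neg_domain :: "'a set \<Rightarrow> ('a \<Rightarrow> real) \<Rightarrow> 'a set" where
  "neg_domain D f = {x\<in>D. f x < 0}"

definition pos_domain :: "'a set \<Rightarrow> ('a \<Rightarrow> real) \<Rightarrow> 'a set" where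
  "pos_domain D f = {x\<in>D. f x > 0}"

definition level_set :: "'a set \<Rightarrow> ('a \<Rightarrow> real) \<Rightarrow> 'a set" where
  "level_set D f = {x\<in>D. f x = 0}"

text \<open>
  A subdomain is selected by \<open>s\<close>: the \<open>j\<close>-th factor is the domain of \<open>\<phi> j\<close> if \<open>s j\<close>
  and the complement of its closure otherwise. Restricting the index set \<open>I\<close> removes factors;
  the empty intersection is \<open>D\<close>.
\<close>

definition subdomain ::
    "'a set \<Rightarrow> (nat \<Rightarrow> bool) \<Rightarrow> (nat \<Rightarrow> 'a \<Rightarrow> real) \<Rightarrow> nat set \<Rightarrow> 'a set" where
  "subdomain D s \<phi> I =
     D \<inter> (\<Inter>j\<in>I. if s j then neg_domain D (\<phi> j) else pos_domain D (\<phi> j))"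

text \<open>
  That the zero set of a level-set function is the boundary of its domain implies that the
  function vanishes identically on no cell; this consequence is all that is required.
\<close>

definition nondegenerate :: "'a::euclidean_space set set \<Rightarrow> ('a \<Rightarrow> real) \<Rightarrow> bool" where
  "nondegenerate T f \<longleftrightarrow> (\<forall>K\<in>T. \<exists>x\<in>K. f x \<noteq> 0)"


section \<open>The intersection condition and the smallness of perturbations\<close>

definition intersection_condition ::
    "'a::euclidean_space set \<Rightarrow> 'a set set \<Rightarrow> nat \<Rightarrow> (nat \<Rightarrow> 'a \<Rightarrow> real) \<Rightarrow> nat \<Rightarrow> bool" where
  "intersection_condition D T n \<phi> k \<longleftrightarrow>
     (\<forall>S. convex S \<and> aff_dim S = int DIM('a) - 2 \<and> S \<subseteq> level_set D (\<phi> k) \<longrightarrow>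
        card {j \<in> {1..n} - {k}. S \<subseteq> level_set D (\<phi> j)} \<le> 1 \<and>
        (\<forall>j \<in> {1..n} - {k}. S \<subseteq> level_set D (\<phi> j) \<longrightarrow> (\<forall>K\<in>T. \<not> S \<subseteq> frontier K)))"

text \<open>
  Polytopes have topologically equivalent geometric elements if their faces (vertices, edges,
  facets, \<dots>) correspond to each other with the same dimensions and the same incidences.
\<close>

definition same_topology :: "'a::euclidean_space set \<Rightarrow> 'a set \<Rightarrow> bool" where
  "same_topology P Q \<longleftrightarrow>
     (\<exists>f. bij_betw f {A. A face_of P} {B. B face_of Q} \<and>
          (\<forall>A. A face_of P \<longrightarrow> aff_dim (f A) = aff_dim A) \<and>
          (\<forall>A B. A face_of P \<and> B face_of P \<longrightarrow> (A \<subseteq> B \<longleftrightarrow> f A \<subseteq> f B)))"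

text \<open>
  Below, \<open>G\<close> is the subdomain without the factors \<open>i\<close> and \<open>k\<close>, and \<open>f\<close> is the perturbed
  level-set function. On a cell \<open>f\<close> is affine, so the sign conditions are the two halfspaces.
\<close>

definition small_perturbations ::
    "'a::euclidean_space set set \<Rightarrow> 'a set \<Rightarrow> ('a \<Rightarrow> real) \<Rightarrow> ('a \<Rightarrow> real) \<Rightarrow> bool" where
  "small_perturbations T G f w \<longleftrightarrow>
     (\<exists>tmax>0. \<forall>K\<in>T. (\<exists>x\<in>K. w x \<noteq> 0) \<longrightarrow> (\<forall>t\<in>{0<..tmax}.
        (let P = closure (G \<inter> K) in
           same_topology {x\<in>P. f x \<le> 0} {x\<in>P. f x + t * w x \<le> 0} \<and>
           same_topology {x\<in>P. f x \<ge> 0} {x\<in>P. f x + t * w x \<ge> 0})))"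


section \<open>Lower-dimensional measure\<close>

text \<open>
  Lebesgue measure of an affine subspace \<open>V\<close>, as a measure on the whole space: the image of
  the product Lebesgue measure under Cartesian coordinates of \<open>V\<close>. By the invariance of
  Lebesgue measure under rigid motions, it does not depend on the coordinates.
\<close>

definition affine_lebesgue :: "'a::euclidean_space set \<Rightarrow> 'a measure" where
  "affine_lebesgue V = (SOME M. \<exists>a B.
     pairwise orthogonal B \<and> (\<forall>b\<in>B. norm b = 1) \<and> V = (\<lambda>v. a + v) ` span B \<and>
     M = distr (\<Pi>\<^sub>M b\<in>B. lborel) borel (\<lambda>c. a + (\<Sum>b\<in>B. c b *\<^sub>R b)))"

text \<open>
  The \<open>m\<close>-dimensional measure of polyhedral sets, completed. Affine subspaces meeting a
  given \<open>m\<close>-dimensional one in lower dimension do not contribute to the measure of its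
  subsets, so on finite unions of subsets of \<open>m\<close>-dimensional affine subspaces this is the
  \<open>m\<close>-dimensional Hausdorff measure. For \<open>m = 0\<close> it is the counting measure.
\<close>

definition surface_measure :: "nat \<Rightarrow> 'a::euclidean_space measure" where
  "surface_measure m = completion (measure_of UNIV (sets borel)
     (\<lambda>A. \<integral>\<^sup>+V. emeasure (affine_lebesgue V) A \<partial>count_space {V. affine V \<and> aff_dim V = int m}))"


lemma emeasure_surface_measure:
  fixes A :: "'a::euclidean_space set"
  assumes "A \<in> sets borel"
  shows "emeasure (surface_measure m) A =
    (\<integral>\<^sup>+V. emeasure (affine_lebesgue V) A \<partial>count_space {V. affine V \<and> aff_dim V = int m})"
proof -
  let ?C = "count_space {V::'a set. affine V \<and> aff_dim V = int m}"
  let ?\<mu> = "\<lambda>A. \<integral>\<^sup>+V. emeasure (affine_lebesgue V) A \<partial>?C"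
  let ?M = "measure_of UNIV (sets borel) ?\<mu>"
  have sets_al: "sets (affine_lebesgue V) = sets borel"
    if V: "affine V" "aff_dim V = int m" for V :: "'a set"
  proof -
    from V have "V \<noteq> {}" by auto
    then obtain a where a: "a \<in> V" by auto
    let ?W = "(\<lambda>v. -a + v) ` V"
    have W: "subspace ?W" using affine_diffs_subspace[OF V(1) a] by simp
    obtain B where B: "pairwise orthogonal B" "\<And>b. b \<in> B \<Longrightarrow> norm b = 1" "span B = ?W"
      using orthonormal_basis_subspace[OF W] by metis
    have "V = (\<lambda>v. a + v) ` span B" unfolding B(3) by (auto simp: image_image)
    with B have "\<exists>M a B. pairwise orthogonal B \<and> (\<forall>b\<in>B. norm b = 1) \<and> V = (\<lambda>v. a + v) ` span B \<and>
      M = distr (\<Pi>\<^sub>M b\<in>B. lborel) borel (\<lambda>c. a + (\<Sum>b\<in>B. c b *\<^sub>R b))" by blast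
    from someI_ex[OF this] show ?thesis
      unfolding affine_lebesgue_def by force
  qed
  have pos: "positive (sets borel) ?\<mu>" by (simp add: positive_def)
  have ca: "countably_additive (sets borel) ?\<mu>"
    unfolding countably_additive_def
  proof (intro allI impI)
    fix A :: "nat \<Rightarrow> 'a set"
    assume A: "range A \<subseteq> sets borel" "disjoint_family A" "\<Union>(range A) \<in> sets borel"
    have "(\<Sum>i. ?\<mu> (A i)) = (\<integral>\<^sup>+V. (\<Sum>i. emeasure (affine_lebesgue V) (A i)) \<partial>?C)"
      by (subst nn_integral_suminf) auto
    also have "\<dots> = ?\<mu> (\<Union>(range A))"
      using A by (intro nn_integral_cong suminf_emeasure) (auto simp: sets_al)
    finally show "(\<Sum>i. ?\<mu> (A i)) = ?\<mu> (\<Union>(range A))" .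
  qed
  have sets_M: "sets ?M = sets borel"
    using sets.sets_measure_of_eq[of "borel :: 'a measure"] by simp
  have "emeasure ?M A = ?\<mu> A"
    using pos ca assms sets_M by (intro emeasure_measure_of[OF refl]) (auto)
  moreover have "emeasure (surface_measure m) A = emeasure ?M A"
    unfolding surface_measure_def by (rule emeasure_completion[THEN trans]) (use assms sets_M in auto)
  ultimately show ?thesis by simp
qed


section \<open>Conormals and one-sided values\<close>

definition gradient :: "('a::euclidean_space \<Rightarrow> real) \<Rightarrow> 'a \<Rightarrow> 'a" where
  "gradient f x = (THE v. GDERIV f x :> v)"

text \<open>
  \<open>sgn\<close> normalizes a vector. Since the normal of the level set of \<open>fk\<close> is taken along the
  gradient, the conormal has a nonnegative inner product with it, i.e. it points out of the
  domain where \<open>fk\<close> is negative.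
\<close>

definition unit_normal :: "('a::euclidean_space \<Rightarrow> real) \<Rightarrow> 'a \<Rightarrow> 'a" where
  "unit_normal f x = sgn (gradient f x)"

definition conormal :: "('a::euclidean_space \<Rightarrow> real) \<Rightarrow> ('a \<Rightarrow> real) \<Rightarrow> 'a \<Rightarrow> 'a" where
  "conormal fi fk x =
     sgn (unit_normal fk x - (unit_normal fk x \<bullet> unit_normal fi x) *\<^sub>R unit_normal fi x)"

definition conormal_deriv :: "('a::euclidean_space \<Rightarrow> real) \<Rightarrow> ('a \<Rightarrow> real) \<Rightarrow> 'a \<Rightarrow> real" where
  "conormal_deriv fi fk x = conormal fi fk x \<bullet> gradient fk x"

text \<open>
  At a point where \<open>f\<close> has a discontinuity, its limit from within \<open>S\<close>.
\<close>

definition value_from :: "'a::euclidean_space set \<Rightarrow> ('a \<Rightarrow> real) \<Rightarrow> 'a \<Rightarrow> real" where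
  "value_from S f x = (if isCont f x then f x else Lim (at x within S) f)"


section \<open>The functional and its semiderivative\<close>

definition J ::
    "'a::euclidean_space set \<Rightarrow> nat \<Rightarrow> (nat \<Rightarrow> bool) \<Rightarrow> nat \<Rightarrow> ('a \<Rightarrow> real) \<Rightarrow> (nat \<Rightarrow> 'a \<Rightarrow> real) \<Rightarrow> real"
  where
  "J D n s i g \<phi> =
     (LINT x : level_set D (\<phi> i) \<inter> subdomain D s \<phi> ({1..n} - {i}) | surface_measure (DIM('a) - 1). g x)"

definition perturb ::
    "(nat \<Rightarrow> 'a \<Rightarrow> real) \<Rightarrow> nat \<Rightarrow> ('a \<Rightarrow> real) \<Rightarrow> real \<Rightarrow> nat \<Rightarrow> 'a \<Rightarrow> real" where
  "perturb \<phi> k w t = \<phi>(k := (\<lambda>x. \<phi> k x + t * w x))"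

definition diff_quotient ::
    "'a::euclidean_space set \<Rightarrow> nat \<Rightarrow> (nat \<Rightarrow> bool) \<Rightarrow> nat \<Rightarrow> nat \<Rightarrow> ('a \<Rightarrow> real) \<Rightarrow>
     (nat \<Rightarrow> 'a \<Rightarrow> real) \<Rightarrow> ('a \<Rightarrow> real) \<Rightarrow> real \<Rightarrow> real"
  where
  "diff_quotient D n s i k g \<phi> w t = (J D n s i g (perturb \<phi> k w t) - J D n s i g \<phi>) / t"

text \<open>
  Sign of the semiderivative: since \<open>w \<ge> 0\<close>, the perturbation \<open>\<phi> k + t * w\<close> with \<open>t > 0\<close>
  shrinks the domain where \<open>\<phi> k\<close> is negative and enlarges the one where it is positive.
\<close>

definition side_sign :: "(nat \<Rightarrow> bool) \<Rightarrow> nat \<Rightarrow> real" where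
  "side_sign s k = (if s k then -1 else 1)"

end

theory Submission
  imports Defs
begin

text \<open>
  On a cell everything is affine. The zero set of \<open>\<phi> i\<close> lies in a hyperplane \<open>V\<close>, and inside
  \<open>V\<close> the perturbation \<open>\<phi> k + t * w\<close> moves the boundary of a half-space whose initial
  position is the plane \<open>L\<close> of codimension two where \<open>\<phi> i\<close> and \<open>\<phi> k\<close> both vanish. With
  \<open>s\<close> the signed distance from \<open>L\<close> along the conormal and \<open>c\<close> the conormal derivative of
  \<open>\<phi> k\<close>, one has \<open>\<phi> k = c * s\<close> on \<open>V\<close>. The substitution \<open>s = t * \<sigma>\<close> cancels the
  factor \<open>1 / t\<close> of the difference quotient and turns the difference of the two half-space
  indicators into that of \<open>c * \<sigma> + w < 0\<close> and \<open>\<sigma> < 0\<close>, whose integral over \<open>\<sigma>\<close> is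
  \<open>- w / c\<close>. Dominated convergence gives the limit \<open>- (\<integral> H * w / c)\<close> over \<open>L\<close> for every
  bounded integrand \<open>H\<close> of bounded support that is continuous at almost all points of \<open>L\<close>
  (\<open>moving_halfspace_derivative\<close>).

  Here \<open>H\<close> is \<open>g\<close>, restricted to the cell and to the subdomain given by the remaining
  factors. It can be discontinuous only on the boundary of the cell and on the zero sets of the
  other level-set functions. The intersection condition makes these sets meet \<open>L\<close>, inside the
  closed cell, in dimension less than \<open>d - 2\<close> for the dimension \<open>d\<close> of the space, hence in a
  null set (\<open>affine_slice_frontier_thin\<close>). It also rules out that the zero sets of \<open>\<phi> i\<close> and \<open>\<phi> k\<close> coincide on a cell in a piece of dimension
  \<open>d - 1\<close>: such a piece is a polytope, its facets have dimension \<open>d - 2\<close>, and they lie on the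
  boundary of the cell (\<open>affine_slice_codim2\<close>). The resulting formula for one cell is
  \<open>cell_semiderivative\<close>; it holds for \<open>t\<close> tending to zero from either side. The one-sided
  values in the formula agree with the plain ones inside the cells, that is, almost everywhere on
  the domain of integration.

  The integrals over the cells add up to the integral over \<open>D\<close> although the zero set of
  \<open>\<phi> i\<close> may contain a facet common to two cells, because every point is weighted by the
  reciprocal of the number of cells that contain it (\<open>cell_weight\<close>).

  The measure theory behind this is the freedom to choose coordinates. The Lebesgue measure of an
  affine subspace is the same in all orthonormal coordinates (\<open>affine_lebesgue_eq\<close>), since
  translation-invariant measures are unique up to a factor. In coordinates adapted to \<open>L\<close>, the
  measure of \<open>V\<close> is the product of the measure of \<open>L\<close> and that of the line along the
  conormal (\<open>affine_lebesgue_split\<close>). Finally, the surface measure agrees with the Lebesgue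
  measure of \<open>V\<close> on \<open>V\<close> (\<open>affine_lebesgue_density_surface\<close>).
\<close>

section \<open>Lebesgue measure of affine subspaces in orthonormal coordinates\<close>

definition orthonormal :: "'a::euclidean_space set \<Rightarrow> bool" where
  "orthonormal B \<longleftrightarrow> pairwise orthogonal B \<and> (\<forall>b\<in>B. norm b = 1)"

definition coord_map :: "'a::euclidean_space \<Rightarrow> 'a set \<Rightarrow> ('a \<Rightarrow> real) \<Rightarrow> 'a" where
  "coord_map a B c = a + (\<Sum>b\<in>B. c b *\<^sub>R b)"

definition coord_measure :: "'a::euclidean_space \<Rightarrow> 'a set \<Rightarrow> 'a measure" where
  "coord_measure a B = distr (\<Pi>\<^sub>M b\<in>B. lborel) borel (coord_map a B)"

interpretation lborel_product: product_sigma_finite "\<lambda>_::'i. lborel :: real measure"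
  by standard

lemma orthonormal_finite: "orthonormal B \<Longrightarrow> finite B"
  unfolding orthonormal_def by (rule pairwise_orthogonal_imp_finite) auto

lemma orthonormal_inner:
  assumes "orthonormal B" "b \<in> B" "b' \<in> B"
  shows "b \<bullet> b' = (if b = b' then 1 else 0)"
  using assms by (auto simp: orthonormal_def pairwise_def orthogonal_def dot_square_norm)

lemma coord_map_measurable [measurable]:
  "coord_map a B \<in> borel_measurable (\<Pi>\<^sub>M b\<in>B. (lborel :: real measure))"
  unfolding coord_map_def[abs_def]
  by (intro borel_measurable_add borel_measurable_sum borel_measurable_const
      borel_measurable_scaleR) (auto intro!: measurable_component_singleton[THEN measurable_compose])

lemma coord_map_inner:
  assumes "orthonormal B" "b \<in> B"
  shows "(coord_map a B c - a) \<bullet> b = c b"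
proof -
  have "(coord_map a B c - a) \<bullet> b = (\<Sum>b'\<in>B. c b' * (if b' = b then 1 else 0))"
    unfolding coord_map_def using orthonormal_inner[OF assms(1) _ assms(2)]
    by (simp add: inner_sum_left)
  also have "\<dots> = c b" using assms(2) orthonormal_finite[OF assms(1)] by (simp add: if_distrib cong: if_cong)
  finally show ?thesis .
qed

lemma coord_map_norm:
  assumes "orthonormal B"
  shows "(norm (coord_map 0 B c))\<^sup>2 = (\<Sum>b\<in>B. (c b)\<^sup>2)"
proof -
  have "(norm (coord_map 0 B c))\<^sup>2 = coord_map 0 B c \<bullet> (\<Sum>b\<in>B. c b *\<^sub>R b)"
    by (simp add: dot_square_norm[symmetric] coord_map_def)
  also have "\<dots> = (\<Sum>b\<in>B. c b * (coord_map 0 B c \<bullet> b))" by (simp add: inner_sum_right)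
  also have "\<dots> = (\<Sum>b\<in>B. (c b)\<^sup>2)"
    using coord_map_inner[OF assms, of _ 0 c] by (intro sum.cong) (auto simp: power2_eq_square)
  finally show ?thesis .
qed

lemma coord_map_span: "coord_map a B c - a \<in> span B"
  unfolding coord_map_def by (simp add: span_sum span_scale span_base)

lemma sets_coord_measure [simp, measurable_cong]: "sets (coord_measure a B) = sets borel"
  by (simp add: coord_measure_def)

lemma space_coord_measure [simp]: "space (coord_measure a B) = UNIV"
  by (simp add: coord_measure_def)

lemma nn_integral_coord_measure:
  "f \<in> borel_measurable borel \<Longrightarrow>
    (\<integral>\<^sup>+x. f x \<partial>coord_measure a B) = (\<integral>\<^sup>+c. f (coord_map a B c) \<partial>(\<Pi>\<^sub>M b\<in>B. lborel))"
  unfolding coord_measure_def by (rule nn_integral_distr) auto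

lemma AE_coord_measure_span: "AE x in coord_measure a B. x - a \<in> span B"
proof -
  have "closed ((\<lambda>v. a + v) ` span B)" by (intro closed_translation closed_span)
  moreover have "(\<lambda>v. a + v) ` span B = {x. x - a \<in> span B}"
    by (auto simp: image_iff) (metis add_diff_cancel_left' diff_add_cancel add.commute)
  ultimately have "{x. x - a \<in> span B} \<in> sets borel" by auto
  then show ?thesis unfolding coord_measure_def
    by (subst AE_distr_iff) (auto intro!: AE_I2 coord_map_span)
qed

text \<open>
  On boxes this is the translation invariance of Lebesgue measure in each coordinate, and boxes
  determine the product measure.
\<close>

lemma PiM_lborel_translation:
  assumes "finite B"
  shows "distr (\<Pi>\<^sub>M b\<in>B. lborel) (\<Pi>\<^sub>M b\<in>B. lborel) (\<lambda>c. \<lambda>b\<in>B. u b + c b) = (\<Pi>\<^sub>M b\<in>B. (lborel :: real measure))"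
proof (rule lborel_product.PiM_eqI)
  fix A :: "_ \<Rightarrow> real set" assume A: "\<And>b. b \<in> B \<Longrightarrow> A b \<in> sets lborel"
  let ?T = "\<lambda>c. \<lambda>b\<in>B. u b + c b"
  have m [measurable]: "?T \<in> (\<Pi>\<^sub>M b\<in>B. lborel) \<rightarrow>\<^sub>M (\<Pi>\<^sub>M b\<in>B. (lborel :: real measure))"
    by (intro measurable_restrict) measurable
  have A': "(+) (u b) -` A b \<in> sets lborel" if "b \<in> B" for b
    using measurable_sets[of "(+) (u b)" borel borel "A b"] A[OF that] by simp
  have e: "emeasure lborel ((+) (u b) -` A b) = emeasure lborel (A b)" if "b \<in> B" for b
    using A[OF that] lborel_distr_plus[of "u b"] emeasure_distr[of "(+) (u b)" lborel borel "A b"]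
    by simp
  have "?T -` (Pi\<^sub>E B A) \<inter> space (\<Pi>\<^sub>M b\<in>B. (lborel :: real measure)) = Pi\<^sub>E B (\<lambda>b. (+) (u b) -` A b)"
    by (auto simp: space_PiM PiE_def Pi_def extensional_def)
  then show "emeasure (distr (\<Pi>\<^sub>M b\<in>B. lborel) (\<Pi>\<^sub>M b\<in>B. lborel) ?T) (Pi\<^sub>E B A) = (\<Prod>b\<in>B. emeasure lborel (A b))"
    using A assms A' e by (subst emeasure_distr)
      (auto intro!: sets_PiM_I_finite prod.cong simp: lborel_product.emeasure_PiM)
qed (use assms in auto)

lemma coord_measure_translation:
  assumes B: "finite B" and w: "w \<in> span B"
  shows "coord_measure (a + w) B = coord_measure a B"
proof -
  obtain u where u: "w = (\<Sum>b\<in>B. u b *\<^sub>R b)" using w B by (auto simp: span_finite)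
  have m [measurable]: "(\<lambda>c. \<lambda>b\<in>B. u b + c b) \<in> (\<Pi>\<^sub>M b\<in>B. lborel) \<rightarrow>\<^sub>M (\<Pi>\<^sub>M b\<in>B. (lborel :: real measure))"
    by (intro measurable_restrict) measurable
  have "coord_measure a B = distr (distr (\<Pi>\<^sub>M b\<in>B. lborel) (\<Pi>\<^sub>M b\<in>B. lborel) (\<lambda>c. \<lambda>b\<in>B. u b + c b)) borel (coord_map a B)"
    by (simp add: coord_measure_def PiM_lborel_translation[OF B])
  also have "\<dots> = distr (\<Pi>\<^sub>M b\<in>B. lborel) borel (coord_map a B \<circ> (\<lambda>c. \<lambda>b\<in>B. u b + c b))"
    by (rule distr_distr) auto
  also have "coord_map a B \<circ> (\<lambda>c. \<lambda>b\<in>B. u b + c b) = coord_map (a + w) B"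
    by (auto simp: coord_map_def fun_eq_iff u algebra_simps sum.distrib)
  finally show ?thesis by (simp add: coord_measure_def)
qed

lemma nn_integral_coord_measure_translation:
  assumes B: "finite B" and w: "w \<in> span B" and f [measurable]: "f \<in> borel_measurable borel"
  shows "(\<integral>\<^sup>+x. f (w + x) \<partial>coord_measure 0 B) = (\<integral>\<^sup>+x. f x \<partial>coord_measure 0 B)"
proof -
  have "(\<integral>\<^sup>+x. f x \<partial>coord_measure 0 B) = (\<integral>\<^sup>+x. f x \<partial>coord_measure w B)"
    using coord_measure_translation[OF B w, of 0] by simp
  then show ?thesis
    by (simp add: nn_integral_coord_measure coord_map_def add.assoc)
qed

text \<open>
  In orthonormal coordinates each coordinate is bounded by the norm, so a ball is contained in a
  cube.
\<close>

lemma emeasure_coord_measure_cball_finite: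
  assumes B: "orthonormal B"
  shows "emeasure (coord_measure a B) (cball x r) < \<infinity>"
proof -
  let ?P = "\<Pi>\<^sub>M b\<in>B. (lborel :: real measure)"
  have fB: "finite B" by (rule orthonormal_finite[OF B])
  let ?q = "r + norm (x - a)"
  have "emeasure (coord_measure a B) (cball x r) = emeasure ?P (coord_map a B -` cball x r \<inter> space ?P)"
    unfolding coord_measure_def by (rule emeasure_distr) auto
  also have "\<dots> \<le> emeasure ?P (Pi\<^sub>E B (\<lambda>b. {-?q..?q}))"
  proof (rule emeasure_mono)
    show "coord_map a B -` cball x r \<inter> space ?P \<subseteq> Pi\<^sub>E B (\<lambda>b. {-?q..?q})"
    proof
      fix c assume c: "c \<in> coord_map a B -` cball x r \<inter> space ?P"
      have "\<bar>c b\<bar> \<le> ?q" if "b \<in> B" for b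
      proof -
        have "\<bar>c b\<bar> = \<bar>(coord_map a B c - a) \<bullet> b\<bar>" using coord_map_inner[OF B that] by simp
        also have "\<dots> \<le> norm (coord_map a B c - a) * norm b" by (rule Cauchy_Schwarz_ineq2)
        also have "\<dots> = norm (coord_map a B c - a)" using B that by (simp add: orthonormal_def)
        also have "\<dots> \<le> norm (coord_map a B c - x) + norm (x - a)"
          using norm_triangle_ineq[of "coord_map a B c - x" "x - a"] by simp
        also have "\<dots> \<le> ?q" using c by (simp add: dist_norm norm_minus_commute)
        finally show ?thesis .
      qed
      with c show "c \<in> Pi\<^sub>E B (\<lambda>b. {-?q..?q})" by (auto simp: space_PiM PiE_def Pi_def abs_le_iff) (smt (verit))
    qed
  qed (use fB in \<open>auto intro!: sets_PiM_I_finite\<close>)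
  also have "\<dots> = (\<Prod>b\<in>B. emeasure lborel {-?q..?q})"
    using fB by (intro lborel_product.emeasure_PiM) auto
  also have "\<dots> < \<infinity>" by (simp add: power_less_top_ennreal emeasure_lborel_Icc_eq)
  finally show ?thesis .
qed

lemma emeasure_coord_measure_ball_pos:
  assumes B: "orthonormal B"
  shows "emeasure (coord_measure 0 B) (cball 0 1) > 0"
proof -
  let ?P = "\<Pi>\<^sub>M b\<in>B. (lborel :: real measure)"
  have fB: "finite B" by (rule orthonormal_finite[OF B])
  let ?q = "1 / (real (card B) + 1)"
  have "0 < (\<Prod>b\<in>B. emeasure lborel {0..?q})" by (auto simp: zero_less_iff_neq_zero ennreal_eq_0_iff not_le fB)
  also have "\<dots> = emeasure ?P (Pi\<^sub>E B (\<lambda>b. {0..?q}))"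
    using fB by (intro lborel_product.emeasure_PiM[symmetric]) auto
  also have "\<dots> \<le> emeasure ?P (coord_map 0 B -` cball 0 1 \<inter> space ?P)"
  proof (rule emeasure_mono)
    show "Pi\<^sub>E B (\<lambda>b. {0..?q}) \<subseteq> coord_map 0 B -` cball 0 1 \<inter> space ?P"
    proof
      fix c assume c: "c \<in> Pi\<^sub>E B (\<lambda>b. {0..?q})"
      have "norm (coord_map 0 B c) \<le> (\<Sum>b\<in>B. norm (c b *\<^sub>R b))"
        unfolding coord_map_def by (simp only: add_0_left norm_sum)
      also have "\<dots> \<le> (\<Sum>b\<in>B. ?q)"
        using c B by (intro sum_mono) (force simp: orthonormal_def PiE_def Pi_def)
      also have "\<dots> \<le> 1" by (simp add: field_simps)
      finally show "c \<in> coord_map 0 B -` cball 0 1 \<inter> space ?P"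
        using c by (auto simp: space_PiM PiE_def)
    qed
  qed measurable
  also have "\<dots> = emeasure (coord_measure 0 B) (cball 0 1)"
    unfolding coord_measure_def by (rule emeasure_distr[symmetric]) auto
  finally show ?thesis .
qed

text \<open>
  Both sides are the product measure of the points whose coordinates have a sum of squares at most
  1, and a bijection of the bases carries one onto the other.
\<close>

lemma emeasure_coord_measure_ball_eq:
  assumes B: "orthonormal B" and C: "orthonormal C" and card: "card B = card C"
  shows "emeasure (coord_measure 0 B) (cball 0 1) = emeasure (coord_measure 0 C) (cball 0 1)"
proof -
  have fB: "finite B" and fC: "finite C" using B C orthonormal_finite by auto
  obtain h where h: "bij_betw h B C" using card fB fC by (meson finite_same_card_bij)
  let ?PB = "\<Pi>\<^sub>M b\<in>B. (lborel :: real measure)" and ?PC = "\<Pi>\<^sub>M b\<in>C. (lborel :: real measure)"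
  let ?T = "\<lambda>c. \<lambda>b\<in>B. c (h b)"
  have hC: "b \<in> B \<Longrightarrow> h b \<in> C" for b using h by (auto simp: bij_betw_def)
  have m [measurable]: "?T \<in> ?PC \<rightarrow>\<^sub>M ?PB"
    using hC by (intro measurable_restrict) auto
  have eq: "distr ?PC ?PB ?T = ?PB"
  proof (rule lborel_product.PiM_eqI)
    fix A :: "_ \<Rightarrow> real set" assume A: "\<And>b. b \<in> B \<Longrightarrow> A b \<in> sets lborel"
    have inv: "inv_into B h (h b) = b" if "b \<in> B" for b using h that by (simp add: bij_betw_inv_into_left)
    have sub: "inv_into B h b \<in> B" if "b \<in> C" for b using h that by (metis bij_betw_def inv_into_into)
    have "?T -` (Pi\<^sub>E B A) \<inter> space ?PC = Pi\<^sub>E C (\<lambda>b. A (inv_into B h b))"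
      using hC inv sub h
      by (auto simp: space_PiM PiE_def Pi_def extensional_def bij_betw_def)
    then have "emeasure (distr ?PC ?PB ?T) (Pi\<^sub>E B A) = (\<Prod>b\<in>C. emeasure lborel (A (inv_into B h b)))"
      using A fB fC sub by (subst emeasure_distr)
        (auto intro!: sets_PiM_I_finite simp: lborel_product.emeasure_PiM)
    also have "\<dots> = (\<Prod>b\<in>B. emeasure lborel (A b))"
      by (subst prod.reindex_bij_betw[OF h, symmetric]) (simp add: inv cong: prod.cong)
    finally show "emeasure (distr ?PC ?PB ?T) (Pi\<^sub>E B A) = (\<Prod>b\<in>B. emeasure lborel (A b))" .
  qed (use fB in auto)
  have "emeasure (coord_measure 0 B) (cball 0 1) = emeasure (distr ?PC ?PB ?T) (coord_map 0 B -` cball 0 1 \<inter> space ?PB)"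
    unfolding eq unfolding coord_measure_def by (rule emeasure_distr) auto
  also have "\<dots> = emeasure ?PC (?T -` (coord_map 0 B -` cball 0 1 \<inter> space ?PB) \<inter> space ?PC)"
    by (rule emeasure_distr) measurable
  also have "?T -` (coord_map 0 B -` cball 0 1 \<inter> space ?PB) \<inter> space ?PC = coord_map 0 C -` cball 0 1 \<inter> space ?PC"
  proof -
    have "norm (coord_map 0 B (?T c)) = norm (coord_map 0 C c)" for c
    proof -
      have "(norm (coord_map 0 B (?T c)))\<^sup>2 = (\<Sum>b\<in>B. (c (h b))\<^sup>2)"
        unfolding coord_map_norm[OF B] by (intro sum.cong) auto
      also have "\<dots> = (norm (coord_map 0 C c))\<^sup>2"
        unfolding coord_map_norm[OF C] by (rule sum.reindex_bij_betw[OF h])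
      finally show ?thesis by simp
    qed
    then show ?thesis by (auto simp: space_PiM)
  qed
  also have "emeasure ?PC \<dots> = emeasure (coord_measure 0 C) (cball 0 1)"
    unfolding coord_measure_def by (rule emeasure_distr[symmetric]) auto
  finally show ?thesis .
qed

lemma sigma_finite_coord_measure:
  assumes B: "orthonormal B"
  shows "sigma_finite_measure (coord_measure a B)"
proof (rule sigma_finite_measure.intro, intro exI conjI)
  let ?A = "range (\<lambda>n. cball (0::'a) (real n))"
  show "countable ?A" "?A \<subseteq> sets (coord_measure a B)" by auto
  show "\<Union>?A = space (coord_measure a B)"
    by (auto intro: real_arch_simple)
  show "\<forall>A\<in>?A. emeasure (coord_measure a B) A \<noteq> \<infinity>"
    using emeasure_coord_measure_cball_finite[OF B] by (auto simp: less_top)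
qed

text \<open>
  Uniqueness of translation-invariant measures. For measures \<open>\<mu>\<close> and \<open>\<nu>\<close> on the
  common span that are invariant under its translations, and for \<open>g\<close> even, two shifts and an
  exchange of the order of integration give
  \<open>(\<integral>g d\<nu>) * (\<integral>f d\<mu>) = (\<integral>g d\<mu>) * (\<integral>f d\<nu>)\<close>. The unit ball is an even
  set to which both measures give the same positive and finite value, so it can be cancelled.
\<close>

lemma coord_measure_basis_independent:
  assumes B: "orthonormal B" and C: "orthonormal C" and span: "span B = span C"
  shows "coord_measure 0 B = coord_measure 0 C"
proof (rule measure_eqI)
  fix A assume "A \<in> sets (coord_measure 0 B)"
  then have A [measurable]: "A \<in> sets borel" by simp
  let ?\<mu> = "coord_measure 0 B" and ?\<nu> = "coord_measure 0 C"
  interpret \<mu>: sigma_finite_measure ?\<mu> by (rule sigma_finite_coord_measure[OF B])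
  interpret \<nu>: sigma_finite_measure ?\<nu> by (rule sigma_finite_coord_measure[OF C])
  interpret pair_sigma_finite ?\<mu> ?\<nu> ..
  have fB: "finite B" and fC: "finite C" using B C orthonormal_finite by auto
  have indep: "independent B" "independent C"
    using B C unfolding orthonormal_def by (metis norm_zero pairwise_orthogonal_independent zero_neq_one)+
  then have card: "card B = card C" using span by (metis dim_eq_card dim_span)
  define f g where "f = (indicator A :: 'a \<Rightarrow> ennreal)" and "g = (indicator (cball 0 1) :: 'a \<Rightarrow> ennreal)"
  have f [measurable]: "f \<in> borel_measurable borel" and g [measurable]: "g \<in> borel_measurable borel"
    by (auto simp: f_def g_def intro!: borel_measurable_indicator)
  have sym: "g (- x) = g x" for x by (simp add: g_def indicator_def)
  have AE\<nu>: "AE y in ?\<nu>. y \<in> span B" using AE_coord_measure_span[of 0 C] span by simp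
  have AE\<mu>: "AE x in ?\<mu>. x \<in> span C" using AE_coord_measure_span[of 0 B] span by simp
  have "(\<integral>\<^sup>+y. g y * (\<integral>\<^sup>+x. f x \<partial>?\<mu>) \<partial>?\<nu>) = (\<integral>\<^sup>+y. g y * (\<integral>\<^sup>+x. f (y + x) \<partial>?\<mu>) \<partial>?\<nu>)"
    using AE\<nu> by (intro nn_integral_cong_AE, eventually_elim)
      (simp add: nn_integral_coord_measure_translation[OF fB])
  also have "\<dots> = (\<integral>\<^sup>+y. (\<integral>\<^sup>+x. g y * f (y + x) \<partial>?\<mu>) \<partial>?\<nu>)"
    by (intro nn_integral_cong nn_integral_cmult[symmetric]) measurable
  also have "\<dots> = (\<integral>\<^sup>+x. (\<integral>\<^sup>+y. g y * f (y + x) \<partial>?\<nu>) \<partial>?\<mu>)"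
    by (rule Fubini') measurable
  \<comment> \<open>Invariance of \<open>\<nu>\<close> moves the shift from \<open>f\<close> to \<open>g\<close>.\<close>
  also have "\<dots> = (\<integral>\<^sup>+x. (\<integral>\<^sup>+y. g (y - x) * f y \<partial>?\<nu>) \<partial>?\<mu>)"
    using AE\<mu>
  proof (intro nn_integral_cong_AE, eventually_elim)
    fix x assume "x \<in> span C"
    from nn_integral_coord_measure_translation[OF fC this, of "\<lambda>y. g (y - x) * f y"]
    show "(\<integral>\<^sup>+y. g y * f (y + x) \<partial>?\<nu>) = (\<integral>\<^sup>+y. g (y - x) * f y \<partial>?\<nu>)"
      by (simp add: add.commute)
  qed
  also have "\<dots> = (\<integral>\<^sup>+y. (\<integral>\<^sup>+x. g (y - x) * f y \<partial>?\<mu>) \<partial>?\<nu>)"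
    by (rule Fubini'[symmetric]) measurable
  \<comment> \<open>As \<open>g\<close> is even, invariance of \<open>\<mu>\<close> removes the shift.\<close>
  also have "\<dots> = (\<integral>\<^sup>+y. (\<integral>\<^sup>+x. g x \<partial>?\<mu>) * f y \<partial>?\<nu>)"
    using AE\<nu>
  proof (intro nn_integral_cong_AE, eventually_elim)
    fix y assume "y \<in> span B"
    then have "-y \<in> span B" by (rule span_neg)
    from nn_integral_coord_measure_translation[OF fB this g]
    show "(\<integral>\<^sup>+x. g (y - x) * f y \<partial>?\<mu>) = (\<integral>\<^sup>+x. g x \<partial>?\<mu>) * f y"
      using sym[of "y - _"] by (simp add: nn_integral_multc)
  qed
  finally have "(\<integral>\<^sup>+y. g y * (\<integral>\<^sup>+x. f x \<partial>?\<mu>) \<partial>?\<nu>) = (\<integral>\<^sup>+y. (\<integral>\<^sup>+x. g x \<partial>?\<mu>) * f y \<partial>?\<nu>)" .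
  then have eq: "emeasure ?\<nu> (cball 0 1) * emeasure ?\<mu> A = emeasure ?\<mu> (cball 0 1) * emeasure ?\<nu> A"
    by (subst (asm) nn_integral_multc, measurable, subst (asm) nn_integral_cmult, measurable)
      (simp add: f_def g_def)
  have "emeasure ?\<nu> (cball 0 1) = emeasure ?\<mu> (cball 0 1)"
    by (rule emeasure_coord_measure_ball_eq[OF C B card[symmetric]])
  moreover have "emeasure ?\<nu> (cball 0 1) \<noteq> 0" "emeasure ?\<nu> (cball 0 1) \<noteq> \<infinity>"
    using emeasure_coord_measure_ball_pos[OF C] emeasure_coord_measure_cball_finite[OF C, of 0 0 1] by auto
  ultimately show "emeasure ?\<mu> A = emeasure ?\<nu> A"
    using eq by (metis ennreal_mult_cancel_left infinity_ennreal_def)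
qed simp

text \<open>
  The origin and the basis selected by the choice operator differ from the given ones by a
  translation along \<open>span B\<close> and by a change of orthonormal basis; neither affects the measure.
\<close>

lemma affine_lebesgue_eq:
  assumes B: "orthonormal B" and V: "V = (\<lambda>v. a + v) ` span B"
  shows "affine_lebesgue V = coord_measure a B"
proof -
  have cm: "distr (\<Pi>\<^sub>M b\<in>B. lborel) borel (\<lambda>c. a + (\<Sum>b\<in>B. c b *\<^sub>R b)) = coord_measure a B" for a :: 'a and B
    by (simp add: coord_measure_def coord_map_def[abs_def])
  have "\<exists>M a B. pairwise orthogonal B \<and> (\<forall>b\<in>B. norm b = 1) \<and> V = (\<lambda>v. a + v) ` span B \<and>
      M = distr (\<Pi>\<^sub>M b\<in>B. lborel) borel (\<lambda>c. a + (\<Sum>b\<in>B. c b *\<^sub>R b))"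
    using B V by (auto simp: orthonormal_def)
  from someI_ex[OF this] have "\<exists>a B. pairwise orthogonal B \<and> (\<forall>b\<in>B. norm b = 1) \<and>
      V = (\<lambda>v. a + v) ` span B \<and> affine_lebesgue V = coord_measure a B"
    unfolding affine_lebesgue_def cm .
  then obtain a' B' where B': "orthonormal B'" and V': "V = (\<lambda>v. a' + v) ` span B'"
    and eq: "affine_lebesgue V = coord_measure a' B'"
    unfolding orthonormal_def by metis
  have "a \<in> V" "a' \<in> V" using V V' by (auto intro: image_eqI[of _ _ 0] simp: span_zero)
  obtain u where u: "a' = a + u" "u \<in> span B" using \<open>a' \<in> V\<close> unfolding V by blast
  obtain u' where u': "a = a' + u'" "u' \<in> span B'" using \<open>a \<in> V\<close> unfolding V' by blast
  have fB: "finite B" by (rule orthonormal_finite[OF B])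
  have span: "span B = span B'"
  proof (intro set_eqI iffI)
    fix v assume "v \<in> span B"
    then have "a + v \<in> V" using V by auto
    then obtain v' where "a + v = a' + v'" "v' \<in> span B'" using V' by auto
    then have "v = v' - u'" using u' by (simp add: algebra_simps)
    then show "v \<in> span B'" using \<open>v' \<in> span B'\<close> u' by (simp add: span_diff)
  next
    fix v assume "v \<in> span B'"
    then have "a' + v \<in> V" using V' by auto
    then obtain v' where "a' + v = a + v'" "v' \<in> span B" using V by auto
    then have "v = v' - u" using u by (simp add: algebra_simps)
    then show "v \<in> span B" using \<open>v' \<in> span B\<close> u by (simp add: span_diff)
  qed
  have shift: "coord_measure a' B' = distr (coord_measure 0 B') borel ((+) a')" for a' :: 'a and B'
    unfolding coord_measure_def by (subst distr_distr) (auto simp: coord_map_def[abs_def] comp_def)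
  have "coord_measure a' B' = coord_measure a' B"
    by (simp only: shift[of a' B'] shift[of a' B] coord_measure_basis_independent[OF B B' span])
  also have "\<dots> = coord_measure a B" using coord_measure_translation[OF fB u(2)] u(1) by simp
  finally show ?thesis using eq by simp
qed

section \<open>Product decomposition and null sets of the surface measure\<close>

lemma affine_orthonormal_coordinates:
  fixes V :: "'a::euclidean_space set"
  assumes V: "affine V" "a \<in> V"
  obtains B where "orthonormal B" "V = (\<lambda>v. a + v) ` span B" "aff_dim V = int (card B)"
proof -
  let ?W = "(\<lambda>v. -a + v) ` V"
  have W: "subspace ?W" using affine_diffs_subspace[OF V(1) V(2)] by simp
  obtain B where B: "pairwise orthogonal B" "\<And>b. b \<in> B \<Longrightarrow> norm b = 1" "span B = ?W" "independent B" "card B = dim ?W"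
    using orthonormal_basis_subspace[OF W] by metis
  show thesis
  proof
    show "orthonormal B" using B by (auto simp: orthonormal_def)
    show V': "V = (\<lambda>v. a + v) ` span B" unfolding B(3) by (auto simp: image_image)
    have "aff_dim V = aff_dim (span B)" unfolding V' by (rule aff_dim_translation_eq)
    also have "\<dots> = int (dim ?W)" using aff_dim_subspace[OF subspace_span[of B]] B(3) by simp
    finally show "aff_dim V = int (card B)" using B(5) by simp
  qed
qed

lemma
  assumes "affine V" "V \<noteq> {}"
  shows sets_affine_lebesgue: "sets (affine_lebesgue V) = sets borel"
    and AE_affine_lebesgue: "AE x in affine_lebesgue V. x \<in> V"
    and sigma_finite_affine_lebesgue: "sigma_finite_measure (affine_lebesgue V)"
    and emeasure_affine_lebesgue_cball: "emeasure (affine_lebesgue V) (cball x r) < \<infinity>"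
proof -
  obtain a where "a \<in> V" using assms by auto
  with assms obtain B where B: "orthonormal B" "V = (\<lambda>v. a + v) ` span B"
    using affine_orthonormal_coordinates by metis
  note eq = affine_lebesgue_eq[OF B]
  show "sets (affine_lebesgue V) = sets borel" by (simp add: eq)
  show "sigma_finite_measure (affine_lebesgue V)" unfolding eq by (rule sigma_finite_coord_measure[OF B(1)])
  show "emeasure (affine_lebesgue V) (cball x r) < \<infinity>"
    unfolding eq by (rule emeasure_coord_measure_cball_finite[OF B(1)])
  show "AE x in affine_lebesgue V. x \<in> V"
    unfolding eq using AE_coord_measure_span[of a B]
  proof eventually_elim
    fix x assume "x - a \<in> span B"
    then have "a + (x - a) \<in> V" unfolding B(2) by (rule imageI)
    then show "x \<in> V" by simp
  qed
qed

text \<open>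
  Fubini's theorem for a subspace \<open>L\<close> of codimension one in \<open>V\<close> with unit normal \<open>N\<close>:
  an orthonormal basis of the directions of \<open>L\<close> together with \<open>N\<close> is one for \<open>V\<close>.
\<close>

lemma affine_lebesgue_split:
  fixes L :: "'a::euclidean_space set"
  assumes L: "affine L" "L \<noteq> {}" and N: "norm N = 1"
    and orth: "\<And>x y. x \<in> L \<Longrightarrow> y \<in> L \<Longrightarrow> N \<bullet> (x - y) = 0"
    and V: "V = {y + s *\<^sub>R N |y s. y \<in> L}"
  shows "affine_lebesgue V = distr (lborel \<Otimes>\<^sub>M affine_lebesgue L) borel (\<lambda>(s, y). y + s *\<^sub>R N)"
    and "affine V" and "aff_dim V = aff_dim L + 1"
    and "f \<in> borel_measurable borel \<Longrightarrow>
      (\<integral>\<^sup>+x. f x \<partial>affine_lebesgue V) = (\<integral>\<^sup>+y. (\<integral>\<^sup>+s. f (y + s *\<^sub>R N) \<partial>lborel) \<partial>affine_lebesgue L)"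
proof -
  obtain a where a: "a \<in> L" using L by auto
  obtain B where B: "orthonormal B" "L = (\<lambda>v. a + v) ` span B" and cB: "aff_dim L = int (card B)"
    using affine_orthonormal_coordinates[OF L(1) a] by metis
  have fB: "finite B" by (rule orthonormal_finite[OF B(1)])
  have NB: "N \<bullet> b = 0" if "b \<in> B" for b
    using orth[of "a + b" a] a that B(2) by (auto simp: span_base)
  have nB: "N \<notin> B" using NB[of N] N by auto
  have B': "orthonormal (insert N B)"
    using B(1) N NB nB by (auto simp: orthonormal_def pairwise_insert orthogonal_def inner_commute)
  have V': "V = (\<lambda>v. a + v) ` span (insert N B)"
  proof (intro set_eqI iffI)
    fix x assume "x \<in> V"
    then obtain v s where v: "x = a + v + s *\<^sub>R N" "v \<in> span B" unfolding V B(2) by auto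
    have "v + s *\<^sub>R N \<in> span (insert N B)"
      using v(2) by (auto simp: span_breakdown_eq intro!: exI[of _ s])
    then show "x \<in> (\<lambda>v. a + v) ` span (insert N B)" using v(1) by (auto simp: add.assoc)
  next
    fix x assume "x \<in> (\<lambda>v. a + v) ` span (insert N B)"
    then obtain v s where v: "x = a + v" "v - s *\<^sub>R N \<in> span B" by (auto simp: span_breakdown_eq)
    then have "a + (v - s *\<^sub>R N) \<in> L" unfolding B(2) by (intro imageI)
    then show "x \<in> V" unfolding V using v(1) by (auto intro!: exI[of _ "a + (v - s *\<^sub>R N)"] exI[of _ s])
  qed
  show "affine V" unfolding V' using affine_translation subspace_imp_affine subspace_span by blast
  have "aff_dim V = aff_dim (span (insert N B))" unfolding V' by (rule aff_dim_translation_eq)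
  also have "\<dots> = int (dim (span (insert N B)))" by (rule aff_dim_subspace[OF subspace_span])
  also have "\<dots> = int (card (insert N B))"
    using B' unfolding orthonormal_def
    by (metis dim_span dim_eq_card_independent pairwise_orthogonal_independent norm_zero zero_neq_one)
  finally show "aff_dim V = aff_dim L + 1" using fB nB cB by simp
  have eqL: "affine_lebesgue L = coord_measure a B" by (rule affine_lebesgue_eq[OF B])
  have eqV: "affine_lebesgue V = coord_measure a (insert N B)" by (rule affine_lebesgue_eq[OF B' V'])
  have cm: "coord_map a (insert N B) (y(N := s)) = coord_map a B y + s *\<^sub>R N" for y s
  proof -
    have "(\<Sum>b\<in>B. (y(N := s)) b *\<^sub>R b) = (\<Sum>b\<in>B. y b *\<^sub>R b)" using nB by (intro sum.cong) auto
    then show ?thesis using fB nB by (simp add: coord_map_def)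
  qed
  show *: "(\<integral>\<^sup>+x. f x \<partial>affine_lebesgue V) = (\<integral>\<^sup>+y. (\<integral>\<^sup>+s. f (y + s *\<^sub>R N) \<partial>lborel) \<partial>affine_lebesgue L)"
    if f [measurable]: "f \<in> borel_measurable borel" for f :: "'a \<Rightarrow> ennreal"
  proof -
    have "(\<integral>\<^sup>+x. f x \<partial>affine_lebesgue V) = (\<integral>\<^sup>+c. f (coord_map a (insert N B) c) \<partial>(\<Pi>\<^sub>M b\<in>insert N B. lborel))"
      unfolding eqV by (rule nn_integral_coord_measure[OF f])
    also have "\<dots> = (\<integral>\<^sup>+c. (\<integral>\<^sup>+s. f (coord_map a (insert N B) (c(N := s))) \<partial>lborel) \<partial>(\<Pi>\<^sub>M b\<in>B. lborel))"
      by (rule lborel_product.product_nn_integral_insert[OF fB nB]) measurable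
    also have "\<dots> = (\<integral>\<^sup>+c. (\<integral>\<^sup>+s. f (coord_map a B c + s *\<^sub>R N) \<partial>lborel) \<partial>(\<Pi>\<^sub>M b\<in>B. lborel))"
      by (simp add: cm)
    also have "\<dots> = (\<integral>\<^sup>+y. (\<integral>\<^sup>+s. f (y + s *\<^sub>R N) \<partial>lborel) \<partial>affine_lebesgue L)"
      unfolding eqL by (rule nn_integral_coord_measure[symmetric]) measurable
    finally show ?thesis .
  qed
  have sL [measurable_cong]: "sets (affine_lebesgue L) = sets borel" by (rule sets_affine_lebesgue[OF L])
  interpret L: sigma_finite_measure "affine_lebesgue L" by (rule sigma_finite_affine_lebesgue[OF L])
  interpret pair_sigma_finite "lborel :: real measure" "affine_lebesgue L" ..
  show "affine_lebesgue V = distr (lborel \<Otimes>\<^sub>M affine_lebesgue L) borel (\<lambda>(s, y). y + s *\<^sub>R N)"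
  proof (rule measure_eqI)
    fix A assume "A \<in> sets (affine_lebesgue V)"
    then have A [measurable]: "A \<in> sets borel" by (simp add: eqV)
    have "emeasure (affine_lebesgue V) A = (\<integral>\<^sup>+x. indicator A x \<partial>affine_lebesgue V)"
      by (simp add: eqV)
    also have "\<dots> = (\<integral>\<^sup>+y. (\<integral>\<^sup>+s. indicator A (y + s *\<^sub>R N) \<partial>lborel) \<partial>affine_lebesgue L)"
      by (rule *) measurable
    also have "\<dots> = (\<integral>\<^sup>+z. indicator A (snd z + fst z *\<^sub>R N) \<partial>(lborel \<Otimes>\<^sub>M affine_lebesgue L))"
      using nn_integral_snd[of "\<lambda>z. indicator A (snd z + fst z *\<^sub>R N)"] by simp
    also have "\<dots> = (\<integral>\<^sup>+x. indicator A x \<partial>distr (lborel \<Otimes>\<^sub>M affine_lebesgue L) borel (\<lambda>(s, y). y + s *\<^sub>R N))"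
      by (subst nn_integral_distr) (auto simp: case_prod_beta)
    finally show "emeasure (affine_lebesgue V) A =
        emeasure (distr (lborel \<Otimes>\<^sub>M affine_lebesgue L) borel (\<lambda>(s, y). y + s *\<^sub>R N)) A" by simp
  qed (simp add: eqV)
qed

text \<open>
  If \<open>U\<close> meets \<open>V\<close> but does not contain it, some direction \<open>N\<close> of \<open>V\<close> is orthogonal
  to all directions of \<open>U \<inter> V\<close>. Hence \<open>U \<inter> V\<close> lies in a hyperplane with normal \<open>N\<close>,
  which every line along \<open>N\<close> meets in a single point, and \<open>affine_lebesgue_split\<close>
  integrates zero.
\<close>

lemma emeasure_affine_lebesgue_proper_affine:
  fixes V :: "'a::euclidean_space set"
  assumes V: "affine V" and U: "affine U" and not: "\<not> V \<subseteq> U"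
  shows "emeasure (affine_lebesgue V) U = 0"
proof -
  have V0: "V \<noteq> {}" using not by auto
  have sV [measurable_cong]: "sets (affine_lebesgue V) = sets borel" by (rule sets_affine_lebesgue[OF V V0])
  have Ub: "U \<in> sets borel" using U by (auto intro: borel_closed affine_closed)
  show ?thesis
  proof (cases "U \<inter> V = {}")
    case True
    have "AE x in affine_lebesgue V. x \<notin> U" using AE_affine_lebesgue[OF V V0] by eventually_elim (use True in auto)
    then show ?thesis using Ub sV by (simp add: AE_iff_measurable[OF _ refl] emeasure_eq_AE AE_iff_null sets_eq_imp_space_eq[OF sV] null_sets_def)
  next
    case False
    then obtain p where p: "p \<in> U" "p \<in> V" by auto
    obtain q where q: "q \<in> V" "q \<notin> U" using not by auto
    let ?W = "(\<lambda>x. -p + x) ` (U \<inter> V)"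
    have W: "subspace ?W" using affine_diffs_subspace[of "U \<inter> V" p] p U V by (simp add: affine_Int)
    obtain z n where zn: "z \<in> span ?W" "\<And>x. x \<in> span ?W \<Longrightarrow> orthogonal n x" "q - p = z + n"
      using orthogonal_subspace_decomp_exists[of ?W "q - p"] by metis
    have zW: "z \<in> ?W" using zn(1) W by (simp add: span_eq_iff[THEN iffD2])
    have n0: "n \<noteq> 0"
    proof
      assume "n = 0"
      then have "q - p \<in> ?W" using zn(3) zW by simp
      then show False using q by auto
    qed
    define N where "N = sgn n"
    have N: "norm N = 1" using n0 by (simp add: N_def norm_sgn)
    have Wo: "N \<bullet> (x - p) = 0" if "x \<in> U" "x \<in> V" for x
    proof -
      have "-p + x \<in> span ?W" using that by (auto intro: span_base)
      then show ?thesis using zn(2) by (auto simp: N_def sgn_div_norm orthogonal_def)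
    qed
    have VN: "x + s *\<^sub>R N \<in> V" if "x \<in> V" for x s
    proof -
      obtain u where u: "u \<in> V" "z = -p + u" using zW by auto
      have "n = q - u" using zn(3) u(2) by (simp add: algebra_simps)
      then have "x + s *\<^sub>R N = x + (s / norm n) *\<^sub>R (q - u)" by (simp add: N_def sgn_div_norm divide_inverse)
      also have "\<dots> \<in> V" using mem_affine_3_minus[OF V that q(1) u(1)] .
      finally show ?thesis .
    qed
    define L where "L = V \<inter> {x. N \<bullet> x = N \<bullet> p}"
    have L: "affine L" unfolding L_def by (intro affine_Int V affine_hyperplane)
    have Lp: "p \<in> L" using p by (simp add: L_def)
    have L0: "L \<noteq> {}" using Lp by auto
    have sL [measurable_cong]: "sets (affine_lebesgue L) = sets borel" by (rule sets_affine_lebesgue[OF L L0])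
    have NN: "N \<bullet> N = 1" using N by (simp add: dot_square_norm)
    have VL: "V = {y + s *\<^sub>R N |y s. y \<in> L}"
    proof (intro set_eqI iffI)
      fix x assume x: "x \<in> V"
      let ?s = "N \<bullet> (x - p)"
      have "x - ?s *\<^sub>R N \<in> V"
        using VN[OF x, of "- ?s"] by (simp only: scaleR_minus_left add_uminus_conv_diff)
      then have "x - ?s *\<^sub>R N \<in> L" using NN by (simp add: L_def inner_diff_right)
      then show "x \<in> {y + s *\<^sub>R N |y s. y \<in> L}" by (intro CollectI exI[of _ "x - ?s *\<^sub>R N"] exI[of _ ?s]) simp
    qed (auto simp: L_def VN)
    have orth: "N \<bullet> (x - y) = 0" if "x \<in> L" "y \<in> L" for x y
      using that by (simp add: L_def inner_diff_right)
    let ?H = "{x. N \<bullet> x = N \<bullet> p}"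
    have Hb: "?H \<in> sets borel" by (intro borel_closed closed_hyperplane)
    have "emeasure (affine_lebesgue V) U \<le> emeasure (affine_lebesgue V) ?H"
    proof (rule emeasure_mono_AE)
      show "AE x in affine_lebesgue V. x \<in> U \<longrightarrow> x \<in> ?H"
        using AE_affine_lebesgue[OF V V0] by eventually_elim (use Wo in \<open>auto simp: inner_diff_right\<close>)
    qed (use Hb sV in auto)
    also have "\<dots> = (\<integral>\<^sup>+x. indicator ?H x \<partial>affine_lebesgue V)" using Hb sV by simp
    also have "\<dots> = (\<integral>\<^sup>+y. (\<integral>\<^sup>+s. indicator ?H (y + s *\<^sub>R N) \<partial>lborel) \<partial>affine_lebesgue L)"
      using Hb by (intro affine_lebesgue_split(4)[OF L L0 N orth VL]) auto
    also have "\<dots> = (\<integral>\<^sup>+y. (\<integral>\<^sup>+s. indicator {0::real} s \<partial>lborel) \<partial>affine_lebesgue L)"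
      using AE_affine_lebesgue[OF L L0]
    proof (intro nn_integral_cong_AE, eventually_elim)
      fix y assume "y \<in> L"
      then have "indicator ?H (y + s *\<^sub>R N) = (indicator {0} s :: ennreal)" for s
        using NN by (auto simp: L_def indicator_def inner_add_right)
      then show "(\<integral>\<^sup>+s. indicator ?H (y + s *\<^sub>R N) \<partial>lborel) = (\<integral>\<^sup>+s. indicator {0::real} s \<partial>lborel)" by simp
    qed
    also have "\<dots> = 0" by simp
    finally show ?thesis by simp
  qed
qed

lemma AE_affine_lebesgue_lower_dim:
  fixes V :: "'a::euclidean_space set"
  assumes V: "affine V" and A: "aff_dim A < aff_dim V"
  shows "AE x in affine_lebesgue V. x \<notin> A"
proof -
  have V0: "V \<noteq> {}" using A aff_dim_geq[of A] by auto
  have "\<not> V \<subseteq> affine hull A" using aff_dim_subset[of V "affine hull A"] A by auto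
  then have "emeasure (affine_lebesgue V) (affine hull A) = 0"
    by (intro emeasure_affine_lebesgue_proper_affine V affine_affine_hull)
  moreover have "affine hull A \<in> sets (affine_lebesgue V)"
    unfolding sets_affine_lebesgue[OF V V0] by (intro borel_closed affine_closed affine_affine_hull)
  ultimately have "affine hull A \<in> null_sets (affine_lebesgue V)" by (simp add: null_sets_def)
  then show ?thesis by (rule AE_I') (auto simp: hull_inc)
qed

lemma sets_surface_measure: "sets borel \<subseteq> sets (surface_measure m)"
  unfolding surface_measure_def using sets.sets_measure_of_eq[of "borel :: 'a measure"] by auto

lemma space_surface_measure [simp]: "space (surface_measure m) = UNIV"
  unfolding surface_measure_def by (simp add: space_measure_of_conv)

lemma surface_measurable: "f \<in> borel_measurable borel \<Longrightarrow> f \<in> borel_measurable (surface_measure m)"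
  using sets_surface_measure by (auto simp: measurable_def)

lemma AE_surface_measure_lower_dim:
  fixes A :: "'a::euclidean_space set"
  assumes A: "aff_dim A < int m"
  shows "AE x in surface_measure m. x \<notin> A"
proof -
  have b: "affine hull A \<in> sets borel" by (intro borel_closed affine_closed affine_affine_hull)
  have "emeasure (affine_lebesgue V) (affine hull A) = 0" if V: "affine V" "aff_dim V = int m" for V
  proof -
    have "\<not> V \<subseteq> affine hull A" using aff_dim_subset[of V "affine hull A"] A V by auto
    then show ?thesis by (intro emeasure_affine_lebesgue_proper_affine V affine_affine_hull)
  qed
  then have "emeasure (surface_measure m) (affine hull A) = (\<integral>\<^sup>+V. 0 \<partial>count_space {V::'a set. affine V \<and> aff_dim V = int m})"
    unfolding emeasure_surface_measure[OF b] by (intro nn_integral_cong) auto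
  then have "affine hull A \<in> null_sets (surface_measure m)"
    using b sets_surface_measure[of m] by (auto simp: null_sets_def)
  then show ?thesis by (rule AE_I') (auto simp: hull_inc)
qed

text \<open>
  The surface measure sums the Lebesgue measures of all affine subspaces of dimension \<open>m\<close>. On
  subsets of \<open>V\<close> only the summand of \<open>V\<close> survives, as every other subspace of this
  dimension meets \<open>V\<close> in a null set. The push-forward under the identity replaces the completed
  \<open>\<sigma>\<close>-algebra by the Borel one.
\<close>

lemma affine_lebesgue_density_surface:
  fixes V :: "'a::euclidean_space set"
  assumes V: "affine V" "aff_dim V = int m"
  shows "affine_lebesgue V = density (distr (surface_measure m) borel (\<lambda>x. x)) (indicator V)"
proof (rule measure_eqI)
  have V0: "V \<noteq> {}" using V by auto
  have sV: "sets (affine_lebesgue V) = sets borel" by (rule sets_affine_lebesgue[OF V(1) V0])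
  show "sets (affine_lebesgue V) = sets (density (distr (surface_measure m) borel (\<lambda>x. x)) (indicator V))"
    using sV by simp
  have Vb: "V \<in> sets borel" using V by (auto intro: borel_closed affine_closed)
  have id: "(\<lambda>x::'a. x) \<in> surface_measure m \<rightarrow>\<^sub>M borel" by (intro surface_measurable) auto
  fix A assume "A \<in> sets (affine_lebesgue V)"
  then have A: "A \<in> sets borel" using sV by simp
  let ?C = "{V::'a set. affine V \<and> aff_dim V = int m}"
  have other: "emeasure (affine_lebesgue V') (V \<inter> A) = 0" if V': "V' \<in> ?C - {V}" for V'
  proof -
    have V'0: "V' \<noteq> {}" using V' by auto
    have "\<not> V' \<subseteq> V"
    proof
      assume "V' \<subseteq> V"
      then have "V' = V" using V V' V'0 affine_dim_equal[of V' V] by auto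
      then show False using V' by auto
    qed
    then have "emeasure (affine_lebesgue V') V = 0"
      using V V' by (intro emeasure_affine_lebesgue_proper_affine) auto
    moreover have "emeasure (affine_lebesgue V') (V \<inter> A) \<le> emeasure (affine_lebesgue V') V"
      using V' V'0 Vb sets_affine_lebesgue[of V'] by (intro emeasure_mono) auto
    ultimately show ?thesis by simp
  qed
  have "emeasure (density (distr (surface_measure m) borel (\<lambda>x. x)) (indicator V)) A
      = emeasure (distr (surface_measure m) borel (\<lambda>x. x)) (V \<inter> A)"
    using A Vb by (subst emeasure_density) (auto simp flip: indicator_inter_arith intro!: nn_integral_indicator)
  also have "\<dots> = emeasure (surface_measure m) (V \<inter> A)"
    using A Vb id by (subst emeasure_distr) auto
  also have "\<dots> = (\<integral>\<^sup>+V'. emeasure (affine_lebesgue V') (V \<inter> A) \<partial>count_space ?C)"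
    using A Vb by (intro emeasure_surface_measure) auto
  also have "\<dots> = (\<Sum>V'\<in>{V}. emeasure (affine_lebesgue V') (V \<inter> A))"
    using other V by (intro nn_integral_count_space') auto
  also have "\<dots> = emeasure (affine_lebesgue V) A"
    using AE_affine_lebesgue[OF V(1) V0] A Vb sV by (auto intro!: emeasure_eq_AE)
  finally show "emeasure (affine_lebesgue V) A =
      emeasure (density (distr (surface_measure m) borel (\<lambda>x. x)) (indicator V)) A" by simp
qed

lemma
  fixes V :: "'a::euclidean_space set" and h :: "'a \<Rightarrow> real"
  assumes V: "affine V" "aff_dim V = int m" and h [measurable]: "h \<in> borel_measurable borel"
    and off: "\<And>x. x \<notin> V \<Longrightarrow> h x = 0"
  shows integral_surface_measure_affine: "integral\<^sup>L (surface_measure m) h = integral\<^sup>L (affine_lebesgue V) h"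
    and integrable_surface_measure_affine: "integrable (surface_measure m) h \<longleftrightarrow> integrable (affine_lebesgue V) h"
proof -
  have Vb [measurable]: "V \<in> sets borel" using V by (auto intro: borel_closed affine_closed)
  have id: "(\<lambda>x::'a. x) \<in> surface_measure m \<rightarrow>\<^sub>M borel" by (intro surface_measurable) auto
  let ?D = "distr (surface_measure m) borel (\<lambda>x. x :: 'a)"
  have dens: "affine_lebesgue V = density ?D (\<lambda>x. ennreal (indicator V x))"
    using affine_lebesgue_density_surface[OF V] by (simp add: ennreal_indicator)
  have eq: "indicator V x *\<^sub>R h x = h x" for x using off[of x] by (auto simp: indicator_def)
  have "integral\<^sup>L (affine_lebesgue V) h = (\<integral>x. indicator V x *\<^sub>R h x \<partial>?D)"
    unfolding dens by (rule integral_density) auto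
  also have "\<dots> = integral\<^sup>L (surface_measure m) h"
    unfolding eq using id by (intro integral_distr) auto
  finally show "integral\<^sup>L (surface_measure m) h = integral\<^sup>L (affine_lebesgue V) h" by simp
  have "integrable (affine_lebesgue V) h \<longleftrightarrow> integrable ?D (\<lambda>x. indicator V x *\<^sub>R h x)"
    unfolding dens by (rule integrable_density) auto
  also have "\<dots> \<longleftrightarrow> integrable (surface_measure m) h"
    unfolding eq using id by (intro integrable_distr_eq) auto
  finally show "integrable (surface_measure m) h \<longleftrightarrow> integrable (affine_lebesgue V) h" by simp
qed

section \<open>The derivative of an integral over a moving half-space\<close>

lemma integrable_affine_lebesgue_bounded:
  fixes V :: "'a::euclidean_space set" and h :: "'a \<Rightarrow> real"
  assumes V: "affine V" "V \<noteq> {}" and h: "h \<in> borel_measurable borel"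
    and bound: "\<And>x. \<bar>h x\<bar> \<le> M" and supp: "\<And>x. h x \<noteq> 0 \<Longrightarrow> norm x \<le> r"
  shows "integrable (affine_lebesgue V) h"
proof (rule Bochner_Integration.integrable_bound)
  note sV [measurable_cong] = sets_affine_lebesgue[OF V]
  show "integrable (affine_lebesgue V) (\<lambda>x. M * indicator (cball 0 r) x)"
    using emeasure_affine_lebesgue_cball[OF V, of 0 r] sV
    by (intro integrable_mult_right integrable_real_indicator) auto
  show "h \<in> borel_measurable (affine_lebesgue V)" using h by measurable
  have "0 \<le> M" using bound[of undefined] by linarith
  then have "norm (h x) \<le> norm (M * indicator (cball 0 r) x)" for x
    using bound[of x] supp[of x] by (cases "h x = 0") (auto simp: indicator_def)
  then show "AE x in affine_lebesgue V. norm (h x) \<le> norm (M * indicator (cball 0 r) x)" by simp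
qed

text \<open>
  The integrand is, up to its sign, the indicator of the interval between 0 and \<open>- (u / c)\<close>.
\<close>

lemma integral_halfline_difference:
  fixes c u :: real
  assumes c: "c > 0"
  shows "(\<integral>\<sigma>. of_bool (c * \<sigma> + u < 0) - of_bool (\<sigma> < 0) \<partial>lborel) = - (u / c)"
proof -
  have lt: "c * \<sigma> + u < 0 \<longleftrightarrow> \<sigma> < - (u / c)" for \<sigma>
    using pos_less_divide_eq[OF c, of \<sigma> "- u"] by (auto simp: mult.commute)
  show ?thesis
  proof (cases "u \<le> 0")
    case True
    then have "0 \<le> - (u / c)" using c by (simp add: divide_nonpos_pos)
    then have "of_bool (c * \<sigma> + u < 0) - of_bool (\<sigma> < 0) = (indicator {0..<- (u / c)} \<sigma> :: real)" for \<sigma>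
      unfolding lt by (auto simp: indicator_def)
    then show ?thesis using \<open>0 \<le> - (u / c)\<close> by simp
  next
    case False
    then have "- (u / c) < 0" using c by simp
    then have "of_bool (c * \<sigma> + u < 0) - of_bool (\<sigma> < 0) = - (indicator {- (u / c)..<0} \<sigma> :: real)" for \<sigma>
      unfolding lt by (auto simp: indicator_def)
    then show ?thesis using \<open>- (u / c) < 0\<close> by simp
  qed
qed

text \<open>
  The analytic core. In the coordinates \<open>y + s *\<^sub>R N\<close> of \<open>V\<close> the integrand is supported where
  \<open>s\<close> is of order \<open>t\<close>. Rescaling \<open>s = t * \<sigma>\<close> thus yields integrands with a common
  bounded support that converge wherever \<open>H\<close> is continuous at \<open>y\<close>. Dominated convergence is
  applied twice, on the line along \<open>N\<close> and then on \<open>L\<close>. The velocity \<open>w\<close> may have any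
  sign, so that replacing \<open>w\<close> by \<open>- w\<close> yields the limit from the left.
\<close>

lemma moving_halfspace_derivative:
  fixes L :: "'a::euclidean_space set" and H f w :: "'a \<Rightarrow> real"
  assumes L: "affine L" "L \<noteq> {}" and N: "norm N = 1"
    and orth: "\<And>x y. x \<in> L \<Longrightarrow> y \<in> L \<Longrightarrow> N \<bullet> (x - y) = 0"
    and V: "V = {y + s *\<^sub>R N |y s. y \<in> L}"
    and H: "H \<in> borel_measurable borel" and bound: "\<And>x. \<bar>H x\<bar> \<le> M" and supp: "\<And>x. H x \<noteq> 0 \<Longrightarrow> norm x \<le> r"
    and cont: "AE y in affine_lebesgue L. isCont H y"
    and c: "c > 0" and f: "\<And>y s. y \<in> L \<Longrightarrow> f (y + s *\<^sub>R N) = c * s" and fb: "f \<in> borel_measurable borel"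
    and w: "continuous_on UNIV w"
  shows "((\<lambda>t. ((\<integral>x. H x * of_bool (f x + t * w x < 0) \<partial>affine_lebesgue V)
             - (\<integral>x. H x * of_bool (f x < 0) \<partial>affine_lebesgue V)) / t)
          \<longlongrightarrow> - (\<integral>x. H x * (w x / c) \<partial>affine_lebesgue L)) (at_right 0)"
proof (rule tendsto_at_right_sequentially[of 0 1])
  fix \<tau> :: "nat \<Rightarrow> real"
  assume pos: "\<And>n. 0 < \<tau> n" and le1: "\<And>n. \<tau> n < 1" and lim: "\<tau> \<longlonglongrightarrow> 0"
  note [measurable] = H fb
  have [measurable]: "w \<in> borel_measurable borel" using w by (rule borel_measurable_continuous_onI)
  note sL [measurable_cong] = sets_affine_lebesgue[OF L]
  have VL: "affine V" "V \<noteq> {}" using affine_lebesgue_split(2)[OF L N orth V] V L by auto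
  note sV [measurable_cong] = sets_affine_lebesgue[OF VL]
  interpret L: sigma_finite_measure "affine_lebesgue L" by (rule sigma_finite_affine_lebesgue[OF L])
  interpret pair_sigma_finite "lborel :: real measure" "affine_lebesgue L" ..
  obtain W where W: "\<And>x. norm x \<le> r \<Longrightarrow> \<bar>w x\<bar> \<le> W" "W > 0"
  proof -
    have "bounded (w ` cball 0 r)"
      using w by (intro compact_imp_bounded compact_continuous_image) (auto intro: continuous_on_subset)
    then obtain W where "W > 0" "\<And>x. x \<in> cball 0 r \<Longrightarrow> \<bar>w x\<bar> \<le> W" unfolding bounded_pos by auto
    then show thesis by (intro that[of W]) auto
  qed
  have M0: "0 \<le> M" using bound[of undefined] by linarith
  define I where "I t x = H x * (of_bool (f x + t * w x < 0) - of_bool (f x < 0))" for t x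
  have I [measurable]: "I t \<in> borel_measurable borel" for t unfolding I_def[abs_def] by measurable
  have Ib: "\<bar>I t x\<bar> \<le> M" for t x using bound[of x] M0 by (auto simp: I_def abs_mult)
  have Is: "norm x \<le> r" if "I t x \<noteq> 0" for t x using that supp[of x] by (auto simp: I_def)
  have int: "integrable (affine_lebesgue V) (\<lambda>x. H x * of_bool (f x + t * w x < 0))"
    "integrable (affine_lebesgue V) (\<lambda>x. H x * of_bool (f x < 0))" for t
  proof -
    have "\<bar>H x * of_bool P\<bar> \<le> M" for x P using bound[of x] M0 by auto
    then show "integrable (affine_lebesgue V) (\<lambda>x. H x * of_bool (f x + t * w x < 0))"
      "integrable (affine_lebesgue V) (\<lambda>x. H x * of_bool (f x < 0))"
      by (auto intro!: integrable_affine_lebesgue_bounded[OF VL, where r=r and M=M] supp)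
  qed
  \<comment> \<open>\<open>Q n y\<close> is the part of the difference quotient contributed by the line through \<open>y\<close>.\<close>
  define Q where "Q n y = (\<integral>\<sigma>. I (\<tau> n) (y + (\<tau> n * \<sigma>) *\<^sub>R N) \<partial>lborel)" for n y
  have Qm: "Q n \<in> borel_measurable (affine_lebesgue L)" for n
    unfolding Q_def[abs_def] by measurable
  let ?q = "\<lambda>t. ((\<integral>x. H x * of_bool (f x + t * w x < 0) \<partial>affine_lebesgue V)
             - (\<integral>x. H x * of_bool (f x < 0) \<partial>affine_lebesgue V)) / t"
  have quot: "?q (\<tau> n) = (\<integral>y. Q n y \<partial>affine_lebesgue L)" for n
  proof -
    let ?P = "lborel \<Otimes>\<^sub>M affine_lebesgue L"
    have split: "affine_lebesgue V = distr ?P borel (\<lambda>(s, y). y + s *\<^sub>R N)"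
      by (rule affine_lebesgue_split(1)[OF L N orth V])
    have iI: "integrable (affine_lebesgue V) (I (\<tau> n))"
      by (rule integrable_affine_lebesgue_bounded[OF VL I Ib Is])
    then have iP: "integrable ?P (\<lambda>(s, y). I (\<tau> n) (y + s *\<^sub>R N))"
      unfolding split by (subst (asm) integrable_distr_eq) (auto simp: case_prod_unfold)
    have "(\<integral>x. H x * of_bool (f x + \<tau> n * w x < 0) \<partial>affine_lebesgue V) - (\<integral>x. H x * of_bool (f x < 0) \<partial>affine_lebesgue V)
        = (\<integral>x. I (\<tau> n) x \<partial>affine_lebesgue V)"
      unfolding I_def right_diff_distrib
      by (rule Bochner_Integration.integral_diff[symmetric]) (rule int)+
    also have "\<dots> = (\<integral>z. I (\<tau> n) (snd z + fst z *\<^sub>R N) \<partial>?P)"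
      unfolding split by (subst integral_distr) (auto simp: case_prod_beta)
    also have "\<dots> = (\<integral>y. (\<integral>s. I (\<tau> n) (y + s *\<^sub>R N) \<partial>lborel) \<partial>affine_lebesgue L)"
      using integral_snd[of "\<lambda>s y. I (\<tau> n) (y + s *\<^sub>R N)"] iP by (simp add: case_prod_unfold)
    also have "\<dots> = (\<integral>y. \<tau> n * Q n y \<partial>affine_lebesgue L)"
      unfolding Q_def using pos[of n]
      by (subst lborel_integral_real_affine[where c="\<tau> n" and t=0]) auto
    also have "\<dots> = \<tau> n * (\<integral>y. Q n y \<partial>affine_lebesgue L)" by simp
    finally show ?thesis using pos[of n] by simp
  qed
  have resc: "I (\<tau> n) (y + (\<tau> n * \<sigma>) *\<^sub>R N)
      = H (y + (\<tau> n * \<sigma>) *\<^sub>R N) * (of_bool (c * \<sigma> + w (y + (\<tau> n * \<sigma>) *\<^sub>R N) < 0) - of_bool (\<sigma> < 0))"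
    if y: "y \<in> L" for n y \<sigma>
  proof -
    have "c * (\<tau> n * \<sigma>) + \<tau> n * v = \<tau> n * (c * \<sigma> + v)" for v by (simp add: algebra_simps)
    then have "c * (\<tau> n * \<sigma>) + \<tau> n * v < 0 \<longleftrightarrow> c * \<sigma> + v < 0" for v
      using pos[of n] by (simp add: mult_less_0_iff)
    moreover have "c * (\<tau> n * \<sigma>) < 0 \<longleftrightarrow> \<sigma> < 0" using pos[of n] c by (auto simp: mult_less_0_iff zero_less_mult_iff)
    ultimately show ?thesis using f[OF y] by (simp add: I_def)
  qed
  \<comment> \<open>The two half-line indicators differ only between 0 and \<open>- w / c\<close>. The second bound uses
    \<open>\<tau> n < 1\<close>.\<close>
  have near: "\<bar>\<sigma>\<bar> \<le> W / c" "norm y \<le> r + W / c"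
    if y: "y \<in> L" and nz: "I (\<tau> n) (y + (\<tau> n * \<sigma>) *\<^sub>R N) \<noteq> 0" for n y \<sigma>
  proof -
    have nr: "norm (y + (\<tau> n * \<sigma>) *\<^sub>R N) \<le> r" by (rule Is[OF nz])
    then have "\<bar>w (y + (\<tau> n * \<sigma>) *\<^sub>R N)\<bar> \<le> W" by (rule W)
    moreover have "c * \<sigma> + w (y + (\<tau> n * \<sigma>) *\<^sub>R N) < 0 \<longleftrightarrow> \<not> \<sigma> < 0"
      using nz unfolding resc[OF y] by auto
    moreover have "c * \<sigma> < 0 \<longleftrightarrow> \<sigma> < 0" using c by (simp add: mult_less_0_iff)
    ultimately have "\<bar>c * \<sigma>\<bar> \<le> W" by linarith
    then show s: "\<bar>\<sigma>\<bar> \<le> W / c" using c by (simp add: field_simps abs_mult)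
    have "\<tau> n * \<bar>\<sigma>\<bar> \<le> 1 * (W / c)" using s pos[of n] le1[of n] by (intro mult_mono) auto
    then have "norm ((\<tau> n * \<sigma>) *\<^sub>R N) \<le> W / c" using N pos[of n] by (simp add: abs_mult)
    then show "norm y \<le> r + W / c"
      using nr norm_triangle_ineq4[of "y + (\<tau> n * \<sigma>) *\<^sub>R N" "(\<tau> n * \<sigma>) *\<^sub>R N"] by simp
  qed
  have dom: "norm (I (\<tau> n) (y + (\<tau> n * \<sigma>) *\<^sub>R N)) \<le> M * indicator {-(W / c)..W / c} \<sigma>" if "y \<in> L" for n y \<sigma>
    using near(1)[OF that, of n \<sigma>] Ib[of "\<tau> n" "y + (\<tau> n * \<sigma>) *\<^sub>R N"] M0
    by (cases "I (\<tau> n) (y + (\<tau> n * \<sigma>) *\<^sub>R N) = 0") (auto simp: indicator_def abs_le_iff)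
  have idom: "integrable lborel (\<lambda>\<sigma>. M * indicator {-(W / c)..W / c} \<sigma> :: real)"
    by (intro integrable_mult_right integrable_real_indicator) (auto simp: emeasure_lborel_Icc_eq)
  have "(\<lambda>n. \<integral>y. Q n y \<partial>affine_lebesgue L) \<longlonglongrightarrow> (\<integral>y. - (H y * (w y / c)) \<partial>affine_lebesgue L)"
  proof (rule integral_dominated_convergence)
    show "integrable (affine_lebesgue L) (\<lambda>y. (M * (2 * (W / c))) * indicator (cball 0 (r + W / c)) y)"
      using emeasure_affine_lebesgue_cball[OF L, of 0 "r + W / c"] sL
      by (intro integrable_mult_right integrable_real_indicator) auto
    show "AE y in affine_lebesgue L. norm (Q n y) \<le> (M * (2 * (W / c))) * indicator (cball 0 (r + W / c)) y" for n
      using AE_affine_lebesgue[OF L]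
    proof eventually_elim
      fix y assume y: "y \<in> L"
      show "norm (Q n y) \<le> (M * (2 * (W / c))) * indicator (cball 0 (r + W / c)) y"
      proof (cases "norm y \<le> r + W / c")
        case True
        have "norm (Q n y) \<le> (\<integral>\<sigma>. norm (I (\<tau> n) (y + (\<tau> n * \<sigma>) *\<^sub>R N)) \<partial>lborel)"
          unfolding Q_def by (rule integral_norm_bound)
        also have "\<dots> \<le> (\<integral>\<sigma>. M * indicator {-(W / c)..W / c} \<sigma> \<partial>lborel)"
          by (rule integral_mono'[OF idom dom[OF y]]) (use M0 in simp)
        also have "\<dots> = M * (2 * (W / c))" using W(2) c by simp
        finally show ?thesis using True by simp
      next
        case False
        then have "I (\<tau> n) (y + (\<tau> n * \<sigma>) *\<^sub>R N) = 0" for \<sigma> using near(2)[OF y] by metis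
        then show ?thesis using False by (simp add: Q_def)
      qed
    qed
    show "AE y in affine_lebesgue L. (\<lambda>n. Q n y) \<longlonglongrightarrow> - (H y * (w y / c))"
      using AE_affine_lebesgue[OF L] cont
    proof eventually_elim
      fix y assume y: "y \<in> L" and Hy: "isCont H y"
      have "(\<lambda>n. \<integral>\<sigma>. I (\<tau> n) (y + (\<tau> n * \<sigma>) *\<^sub>R N) \<partial>lborel)
          \<longlonglongrightarrow> (\<integral>\<sigma>. H y * (of_bool (c * \<sigma> + w y < 0) - of_bool (\<sigma> < 0)) \<partial>lborel)"
      proof (rule integral_dominated_convergence[OF _ _ idom])
        show "AE \<sigma> in lborel. norm (I (\<tau> n) (y + (\<tau> n * \<sigma>) *\<^sub>R N)) \<le> M * indicator {-(W / c)..W / c} \<sigma>" for n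
          using dom[OF y] by (intro AE_I2)
        show "AE \<sigma> in lborel. (\<lambda>n. I (\<tau> n) (y + (\<tau> n * \<sigma>) *\<^sub>R N))
            \<longlonglongrightarrow> H y * (of_bool (c * \<sigma> + w y < 0) - of_bool (\<sigma> < 0))"
          \<comment> \<open>At the boundary of the limiting half-line the indicators need not converge.\<close>
          using AE_lborel_singleton[of "- (w y / c)"]
        proof eventually_elim
          fix \<sigma> assume "\<sigma> \<noteq> - (w y / c)"
          then have nz: "c * \<sigma> + w y \<noteq> 0" using c by (auto simp: field_simps)
          have arg: "(\<lambda>n. y + (\<tau> n * \<sigma>) *\<^sub>R N) \<longlonglongrightarrow> y"
            using tendsto_add[OF tendsto_const tendsto_scaleR[OF tendsto_mult[OF lim tendsto_const] tendsto_const], of y \<sigma> N]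
            by simp
          have Hl: "(\<lambda>n. H (y + (\<tau> n * \<sigma>) *\<^sub>R N)) \<longlonglongrightarrow> H y" by (rule isCont_tendsto_compose[OF Hy arg])
          have "isCont w y" using w by (simp add: continuous_on_eq_continuous_at)
          then have wl: "(\<lambda>n. c * \<sigma> + w (y + (\<tau> n * \<sigma>) *\<^sub>R N)) \<longlonglongrightarrow> c * \<sigma> + w y"
            by (intro tendsto_add tendsto_const isCont_tendsto_compose[OF _ arg])
          have "eventually (\<lambda>n. (c * \<sigma> + w (y + (\<tau> n * \<sigma>) *\<^sub>R N) < 0) = (c * \<sigma> + w y < 0)) sequentially"
          proof (cases "c * \<sigma> + w y < 0")
            case True
            from order_tendstoD(2)[OF wl True] show ?thesis by eventually_elim (use True in simp)
          next
            case False
            then have "0 < c * \<sigma> + w y" using nz by simp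
            from order_tendstoD(1)[OF wl this] show ?thesis by eventually_elim (use False in simp)
          qed
          then have "eventually (\<lambda>n. I (\<tau> n) (y + (\<tau> n * \<sigma>) *\<^sub>R N)
              = H (y + (\<tau> n * \<sigma>) *\<^sub>R N) * (of_bool (c * \<sigma> + w y < 0) - of_bool (\<sigma> < 0))) sequentially"
            by eventually_elim (simp add: resc[OF y])
          moreover have "(\<lambda>n. H (y + (\<tau> n * \<sigma>) *\<^sub>R N) * (of_bool (c * \<sigma> + w y < 0) - of_bool (\<sigma> < 0)))
              \<longlonglongrightarrow> H y * (of_bool (c * \<sigma> + w y < 0) - of_bool (\<sigma> < 0))"
            by (intro tendsto_mult Hl tendsto_const)
          ultimately show "(\<lambda>n. I (\<tau> n) (y + (\<tau> n * \<sigma>) *\<^sub>R N))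
              \<longlonglongrightarrow> H y * (of_bool (c * \<sigma> + w y < 0) - of_bool (\<sigma> < 0))"
            by (simp add: tendsto_cong)
        qed
      qed measurable
      then show "(\<lambda>n. Q n y) \<longlonglongrightarrow> - (H y * (w y / c))"
        using integral_halfline_difference[OF c, of "w y"] by (simp add: Q_def)
    qed
  qed (use Qm in \<open>measurable\<close>)
  then show "(\<lambda>n. ?q (\<tau> n)) \<longlonglongrightarrow> - (\<integral>x. H x * (w x / c) \<partial>affine_lebesgue L)"
    unfolding quot by simp
qed simp

section \<open>The semiderivative on one cell\<close>

text \<open>
  Covered by finitely many sets of dimension less than \<open>m\<close>. Unlike a bound on \<open>aff_dim\<close>,
  this is stable under finite unions, and it makes the set null both for \<open>affine_lebesgue\<close> on
  subspaces of dimension \<open>m\<close> and for \<open>surface_measure\<close>.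
\<close>

definition thin :: "int \<Rightarrow> 'a::euclidean_space set \<Rightarrow> bool" where
  "thin m A \<longleftrightarrow> (\<exists>\<B>. finite \<B> \<and> (\<forall>B\<in>\<B>. aff_dim B < m) \<and> A \<subseteq> \<Union>\<B>)"

lemma thin_lower_dim: "aff_dim A < m \<Longrightarrow> thin m A"
  unfolding thin_def by (rule exI[of _ "{A}"]) auto

lemma thin_subset:
  assumes "thin m B" "A \<subseteq> B" shows "thin m A"
proof -
  obtain \<B> where "finite \<B>" "\<forall>C\<in>\<B>. aff_dim C < m" "B \<subseteq> \<Union>\<B>" using assms(1) by (auto simp: thin_def)
  then show ?thesis unfolding thin_def using assms(2) by (intro exI[of _ \<B>]) auto
qed

lemma thin_UN:
  assumes "finite I" "\<And>j. j \<in> I \<Longrightarrow> thin m (A j)"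
  shows "thin m (\<Union>j\<in>I. A j)"
proof -
  have "\<forall>j\<in>I. \<exists>\<B>. finite \<B> \<and> (\<forall>B\<in>\<B>. aff_dim B < m) \<and> A j \<subseteq> \<Union>\<B>"
    using assms(2) unfolding thin_def by simp
  then obtain \<B> where \<B>': "\<forall>j\<in>I. finite (\<B> j) \<and> (\<forall>B\<in>\<B> j. aff_dim B < m) \<and> A j \<subseteq> \<Union>(\<B> j)"
    by (elim bchoice[THEN exE])
  note \<B> = bspec[OF \<B>']
  show ?thesis unfolding thin_def
  proof (intro exI[of _ "\<Union>j\<in>I. \<B> j"] conjI)
    show "finite (\<Union>j\<in>I. \<B> j)" "\<forall>B\<in>\<Union>j\<in>I. \<B> j. aff_dim B < m" using assms(1) \<B> by auto
    show "(\<Union>j\<in>I. A j) \<subseteq> \<Union>(\<Union>j\<in>I. \<B> j)"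
    proof
      fix x assume "x \<in> (\<Union>j\<in>I. A j)"
      then obtain j where "j \<in> I" "x \<in> A j" by auto
      then show "x \<in> \<Union>(\<Union>j\<in>I. \<B> j)" using \<B>[of j] by blast
    qed
  qed
qed

lemma thin_Un: "thin m A \<Longrightarrow> thin m B \<Longrightarrow> thin m (A \<union> B)"
  using thin_UN[of "{False, True}" m "\<lambda>b. if b then A else B"] by (auto simp: Un_commute)

lemma thin_AE:
  assumes "thin m A" and null: "\<And>B. aff_dim B < m \<Longrightarrow> AE x in M. x \<notin> B"
  shows "AE x in M. x \<notin> A"
proof -
  obtain \<B> where \<B>: "finite \<B>" "\<forall>B\<in>\<B>. aff_dim B < m" "A \<subseteq> \<Union>\<B>" using assms(1) by (auto simp: thin_def)
  have "AE x in M. \<forall>B\<in>\<B>. x \<notin> B" using \<B> null by (intro AE_finite_allI) auto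
  then show ?thesis by eventually_elim (use \<B>(3) in auto)
qed

lemma thin_AE_affine_lebesgue: "affine V \<Longrightarrow> thin (aff_dim V) A \<Longrightarrow> AE x in affine_lebesgue V. x \<notin> A"
  by (rule thin_AE) (auto intro: AE_affine_lebesgue_lower_dim)

lemma thin_AE_surface_measure: "thin (int m) A \<Longrightarrow> AE x in surface_measure m. x \<notin> A"
  by (rule thin_AE) (auto intro: AE_surface_measure_lower_dim)

text \<open>
  Otherwise the slice is a polytope of dimension \<open>d - 1\<close>. It has a facet, of dimension
  \<open>d - 2\<close>, and a point of the facet in the interior of \<open>K\<close> would lie in the relative interior of
  the slice. So the facet lies on the boundary of \<open>K\<close>, which the condition on convex subsets \<open>S\<close> of the slice excludes.
\<close>

lemma affine_slice_codim2:
  fixes K :: "'a::euclidean_space set"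
  assumes d: "DIM('a) \<ge> 2" and K: "polytope K" and A: "affine A" "A \<noteq> UNIV"
    and cond: "\<And>S. convex S \<Longrightarrow> aff_dim S = int DIM('a) - 2 \<Longrightarrow> S \<subseteq> K \<inter> A \<Longrightarrow> \<not> S \<subseteq> frontier K"
  shows "aff_dim (K \<inter> A) \<le> int DIM('a) - 2"
proof (rule ccontr)
  let ?P = "K \<inter> A"
  assume not: "\<not> ?thesis"
  have "aff_dim A < int DIM('a)"
    using A aff_dim_eq_full[of A] aff_dim_le_DIM[of A] hull_same[of affine A] by force
  then have dim: "aff_dim ?P = int DIM('a) - 1" using not aff_dim_subset[of ?P A] by auto
  have P: "polytope ?P" using K A(1) by (simp add: polytope_Int_polyhedron affine_imp_polyhedron)
  obtain F where F: "F facet_of ?P" using polytope_facet_exists[OF P] dim d by auto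
  have FP: "F face_of ?P" "F \<noteq> ?P" "F \<subseteq> ?P"
    using F facet_of_irrefl facet_of_imp_face_of[OF F] facet_of_imp_subset[OF F] by blast+
  have "F \<subseteq> frontier K"
  proof
    fix x assume x: "x \<in> F"
    have xP: "x \<in> ?P" using x FP by auto
    have "x \<notin> interior K"
    proof
      assume "x \<in> interior K"
      then obtain e where e: "e > 0" "ball x e \<subseteq> K" by (auto simp: mem_interior)
      have "affine hull ?P \<subseteq> A" using A(1) by (simp add: hull_minimal)
      then have "ball x e \<inter> affine hull ?P \<subseteq> ?P" using e by auto
      then have "x \<in> rel_interior ?P" using xP e(1) by (auto simp: mem_rel_interior_ball)
      then show False using face_of_disjoint_rel_interior[OF FP(1,2)] x by auto
    qed
    then show "x \<in> frontier K" using xP closure_subset[of K] by (auto simp: frontier_def)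
  qed
  moreover have "convex F" by (rule face_of_imp_convex[OF FP(1)]) 
  moreover have "aff_dim F = int DIM('a) - 2" using F dim by (simp add: facet_of_def)
  ultimately show False using cond[of F] FP(3) by auto
qed

text \<open>
  The boundary of \<open>K\<close> is the union of finitely many facets. Each meets \<open>A\<close> in a convex set
  of dimension at most \<open>d - 2\<close>, and the condition on convex subsets \<open>S\<close> excludes equality.
\<close>

lemma affine_slice_frontier_thin:
  fixes K :: "'a::euclidean_space set"
  assumes d: "DIM('a) \<ge> 2" and K: "polytope K" "aff_dim K = int DIM('a)" and A: "affine A" "A \<noteq> UNIV"
    and cond: "\<And>S. convex S \<Longrightarrow> aff_dim S = int DIM('a) - 2 \<Longrightarrow> S \<subseteq> K \<inter> A \<Longrightarrow> \<not> S \<subseteq> frontier K"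
  shows "thin (int DIM('a) - 2) (frontier K \<inter> A)"
proof -
  have poly: "polyhedron K" using K(1) by (rule polytope_imp_polyhedron)
  have cl: "closed K" using K(1) by (rule polytope_imp_closed)
  have "rel_interior K = interior K" using K(2) by (simp add: rel_interior_interior aff_dim_eq_full)
  then have fr: "frontier K = \<Union>{F. F facet_of K}"
    using rel_boundary_of_polyhedron[OF poly] cl by (simp add: frontier_def)
  have "thin (int DIM('a) - 2) (F \<inter> A)" if F: "F facet_of K" for F
  proof -
    have "aff_dim (F \<inter> A) \<le> aff_dim (K \<inter> A)" using facet_of_imp_subset[OF F] by (intro aff_dim_subset) auto
    also have "\<dots> \<le> int DIM('a) - 2" by (rule affine_slice_codim2[OF d K(1) A cond])
    finally have "aff_dim (F \<inter> A) \<le> int DIM('a) - 2" .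
    moreover have "aff_dim (F \<inter> A) \<noteq> int DIM('a) - 2"
    proof
      assume "aff_dim (F \<inter> A) = int DIM('a) - 2"
      moreover have "convex (F \<inter> A)"
        using face_of_imp_convex[OF facet_of_imp_face_of[OF F]] A(1) by (simp add: convex_Int affine_imp_convex)
      moreover have "F \<inter> A \<subseteq> frontier K" using F fr by auto
      ultimately show False using cond[of "F \<inter> A"] facet_of_imp_subset[OF F] by auto
    qed
    ultimately show ?thesis by (intro thin_lower_dim) simp
  qed
  then have "thin (int DIM('a) - 2) (\<Union>F\<in>{F. F facet_of K}. F \<inter> A)"
    using finite_polyhedron_facets[OF poly] by (intro thin_UN) auto
  then show ?thesis by (rule thin_subset) (auto simp: fr)
qed

text \<open>
  The conormal derivative of an affine function with gradient \<open>b\<close> along the zero set of one with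
  gradient \<open>a\<close>. It is 0 if \<open>b\<close> is a multiple of \<open>a\<close>, and division by it then gives 0.
\<close>

definition conormal_slope :: "'a::euclidean_space \<Rightarrow> 'a \<Rightarrow> real" where
  "conormal_slope a b = sgn (sgn b - (sgn b \<bullet> sgn a) *\<^sub>R sgn a) \<bullet> b"

lemma conormal_slope_parallel:
  assumes "sgn b = (sgn b \<bullet> sgn a) *\<^sub>R sgn a"
  obtains r where "b = r *\<^sub>R a"
proof -
  have "b = norm b *\<^sub>R sgn b" by (cases "b = 0") (auto simp: sgn_div_norm)
  also have "\<dots> = (norm b * (sgn b \<bullet> sgn a) / norm a) *\<^sub>R a"
    by (subst assms) (simp add: sgn_div_norm divide_inverse)
  finally show thesis by (rule that)
qed

text \<open>
  \<open>N\<close> is the normalized component of \<open>b\<close> orthogonal to \<open>a\<close>. The last claim makes it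
  orthogonal to the directions along which both affine functions are constant.
\<close>

lemma conormal_transversal:
  fixes a b :: "'a::euclidean_space"
  assumes a: "a \<noteq> 0" and nz: "sgn b - (sgn b \<bullet> sgn a) *\<^sub>R sgn a \<noteq> 0"
  defines "N \<equiv> sgn (sgn b - (sgn b \<bullet> sgn a) *\<^sub>R sgn a)"
  shows "norm N = 1" "N \<bullet> a = 0" "N \<bullet> b > 0" "conormal_slope a b = N \<bullet> b"
    and "\<And>v. a \<bullet> v = 0 \<Longrightarrow> b \<bullet> v = 0 \<Longrightarrow> N \<bullet> v = 0"
proof -
  define m where "m = sgn b - (sgn b \<bullet> sgn a) *\<^sub>R sgn a"
  have N: "N = m /\<^sub>R norm m" by (simp add: N_def m_def sgn_div_norm)
  have m0: "m \<noteq> 0" using nz by (simp add: m_def)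
  show "norm N = 1" using nz by (simp add: N_def norm_sgn)
  show "conormal_slope a b = N \<bullet> b" by (simp add: conormal_slope_def N_def)
  have "sgn a \<bullet> sgn a = 1" using a by (simp add: dot_square_norm norm_sgn)
  then have ms: "m \<bullet> sgn a = 0" by (simp add: m_def inner_diff_left)
  then have ma: "m \<bullet> a = 0" using a by (simp add: sgn_div_norm)
  then show "N \<bullet> a = 0" by (simp add: N)
  have b0: "b \<noteq> 0" using nz by auto
  have "m \<bullet> m = m \<bullet> sgn b - (sgn b \<bullet> sgn a) * (m \<bullet> sgn a)"
    by (subst (2) m_def) (simp only: inner_diff_right inner_scaleR_right)
  then have "m \<bullet> m = m \<bullet> sgn b" using ms by simp
  moreover have "m \<bullet> m > 0" using m0 by simp
  ultimately have "m \<bullet> sgn b > 0" by simp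
  then have "m \<bullet> b > 0" using b0 by (simp add: sgn_div_norm zero_less_mult_iff)
  then show "N \<bullet> b > 0" using m0 by (simp add: N)
  fix v assume "a \<bullet> v = 0" "b \<bullet> v = 0"
  then show "N \<bullet> v = 0" by (simp add: N m_def inner_diff_left sgn_div_norm)
qed

text \<open>
  The affine functions with gradients \<open>a\<close>, \<open>b\<close> and \<open>p\<close> stand for \<open>\<phi> i\<close>,
  \<open>\<phi> k\<close> and \<open>w\<close> on the cell, and \<open>\<sigma>\<close> encodes which side of the zero set of \<open>\<phi> k\<close>
  is integrated over. If \<open>a = 0\<close>, the first function is a nonzero constant and both sides of
  the formula vanish. If \<open>a\<close> and \<open>b\<close> are linearly independent, the claim is
  \<open>moving_halfspace_derivative\<close>. If \<open>b\<close> is a multiple of \<open>a\<close>, the right-hand side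
  vanishes since \<open>conormal_slope\<close> does, and the second function is
  constant on the hyperplane of the first. A nonzero constant keeps its sign under small
  perturbations. If the constant is zero, the slice of the cell has dimension at most \<open>d - 2\<close> by
  \<open>affine_slice_codim2\<close>, and the surface integrals vanish.
\<close>

lemma cell_semiderivative:
  fixes K :: "'a::euclidean_space set" and H :: "'a \<Rightarrow> real" and a b p :: 'a and \<alpha> \<beta> q \<sigma> :: real
  assumes d: "DIM('a) \<ge> 2" and K: "polytope K" "aff_dim K = int DIM('a)"
    and nondeg: "\<exists>x\<in>K. a \<bullet> x + \<alpha> \<noteq> 0"
    and cond: "\<And>S. convex S \<Longrightarrow> aff_dim S = int DIM('a) - 2 \<Longrightarrow>
      S \<subseteq> K \<inter> {x. a \<bullet> x + \<alpha> = 0 \<and> b \<bullet> x + \<beta> = 0} \<Longrightarrow> \<not> S \<subseteq> frontier K"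
    and H: "H \<in> borel_measurable borel" and bound: "\<And>x. \<bar>H x\<bar> \<le> M" and supp: "\<And>x. x \<notin> K \<Longrightarrow> H x = 0"
    and cont: "thin (int DIM('a) - 2)
      {x \<in> interior K. a \<bullet> x + \<alpha> = 0 \<and> b \<bullet> x + \<beta> = 0 \<and> \<not> isCont H x}"
    and \<sigma>: "\<sigma> = 1 \<or> \<sigma> = -1"
  defines "h \<equiv> \<lambda>t x. H x * of_bool (a \<bullet> x + \<alpha> = 0) * of_bool (\<sigma> * (b \<bullet> x + \<beta> + t * (p \<bullet> x + q)) < 0)"
    and "l \<equiv> \<lambda>x. H x * of_bool (a \<bullet> x + \<alpha> = 0) * of_bool (b \<bullet> x + \<beta> = 0) * ((p \<bullet> x + q) / conormal_slope a b)"
  shows "integrable (surface_measure (DIM('a) - 1)) (h t)"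
    and "integrable (surface_measure (DIM('a) - 2)) l"
    and "((\<lambda>t. (integral\<^sup>L (surface_measure (DIM('a) - 1)) (h t) - integral\<^sup>L (surface_measure (DIM('a) - 1)) (h 0)) / t)
      \<longlongrightarrow> - \<sigma> * integral\<^sup>L (surface_measure (DIM('a) - 2)) l) (at 0)"
proof -
  define V where "V = {x. a \<bullet> x + \<alpha> = 0}"
  define L where "L = {x. a \<bullet> x + \<alpha> = 0 \<and> b \<bullet> x + \<beta> = 0}"
  let ?S1 = "surface_measure (DIM('a) - 1) :: 'a measure" and ?S2 = "surface_measure (DIM('a) - 2) :: 'a measure"
  note [measurable] = H
  have hm [measurable]: "h t \<in> borel_measurable borel" for t unfolding h_def by measurable
  have lm [measurable]: "l \<in> borel_measurable borel" unfolding l_def by measurable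
  have "bounded K" "closed K" using K(1) by (auto simp: polytope_imp_bounded polytope_imp_closed)
  then obtain r where r: "\<And>x. x \<in> K \<Longrightarrow> norm x \<le> r" by (auto simp: bounded_iff)
  have suppr: "norm x \<le> r" if "H x \<noteq> 0" for x using that supp r by metis
  have M0: "0 \<le> M" using bound[of undefined] by linarith
  obtain W where W: "\<And>x. x \<in> K \<Longrightarrow> \<bar>p \<bullet> x + q\<bar> \<le> W" "W > 0"
  proof (rule that[of "norm p * \<bar>r\<bar> + \<bar>q\<bar> + 1"])
    fix x assume "x \<in> K"
    have "\<bar>p \<bullet> x\<bar> \<le> norm p * norm x" by (rule Cauchy_Schwarz_ineq2)
    also have "\<dots> \<le> norm p * \<bar>r\<bar>" using r[OF \<open>x \<in> K\<close>] by (intro mult_left_mono) auto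
    finally show "\<bar>p \<bullet> x + q\<bar> \<le> norm p * \<bar>r\<bar> + \<bar>q\<bar> + 1" by linarith
  qed (auto intro: add_nonneg_pos)
  have hb: "\<bar>h t x\<bar> \<le> M" for t x using bound[of x] M0 by (auto simp: h_def)
  have hs: "norm x \<le> r" if "h t x \<noteq> 0" for t x using that suppr by (auto simp: h_def)
  have trivial: "integrable ?S1 (h t) \<and> integrable ?S2 l \<and>
      ((\<lambda>t. (integral\<^sup>L ?S1 (h t) - integral\<^sup>L ?S1 (h 0)) / t) \<longlongrightarrow> - \<sigma> * integral\<^sup>L ?S2 l) (at 0)"
    if "\<And>x. l x = 0" "\<And>t. integrable ?S1 (h t)"
      "eventually (\<lambda>t. integral\<^sup>L ?S1 (h t) = integral\<^sup>L ?S1 (h 0)) (at 0)" for t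
  proof -
    have l0: "l = (\<lambda>x. 0)" using that(1) by auto
    have "eventually (\<lambda>t. (integral\<^sup>L ?S1 (h t) - integral\<^sup>L ?S1 (h 0)) / t = 0) (at 0)"
      using that(3) by eventually_elim simp
    then show ?thesis using that(2) by (simp add: l0 tendsto_eventually)
  qed
  have main: "integrable ?S1 (h t) \<and> integrable ?S2 l \<and>
      ((\<lambda>t. (integral\<^sup>L ?S1 (h t) - integral\<^sup>L ?S1 (h 0)) / t) \<longlongrightarrow> - \<sigma> * integral\<^sup>L ?S2 l) (at 0)" for t
  proof (cases "a = 0")
    case True
    then have "\<alpha> \<noteq> 0" using nondeg by auto
    with True have "h t = (\<lambda>x. 0)" "l = (\<lambda>x. 0)" for t by (auto simp: h_def l_def)
    then show ?thesis by simp
  next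
    case a0: False
    have Vh: "V = {x. a \<bullet> x = - \<alpha>}" by (auto simp: V_def)
    have V: "affine V" unfolding Vh by (rule affine_hyperplane)
    have dV: "aff_dim V = int (DIM('a) - 1)" unfolding Vh using a0 d by (simp add: aff_dim_hyperplane of_nat_diff)
    have V0: "V \<noteq> {}" using dV d by auto
    have VU: "V \<noteq> UNIV" using dV d by auto
    have hV: "x \<notin> V \<Longrightarrow> h t x = 0" for t x by (simp add: h_def V_def)
    have hint: "integrable ?S1 (h t)" for t
      by (rule iffD2[OF integrable_surface_measure_affine[OF V dV hm hV] integrable_affine_lebesgue_bounded[OF V V0 hm hb hs]])
    note sV [measurable_cong] = sets_affine_lebesgue[OF V V0]
    have Jh: "integral\<^sup>L ?S1 (h t) = (\<integral>x. H x * of_bool (\<sigma> * (b \<bullet> x + \<beta> + t * (p \<bullet> x + q)) < 0) \<partial>affine_lebesgue V)" for t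
    proof -
      have "integral\<^sup>L ?S1 (h t) = integral\<^sup>L (affine_lebesgue V) (h t)"
        by (rule integral_surface_measure_affine[OF V dV hm hV])
      also have "\<dots> = (\<integral>x. H x * of_bool (\<sigma> * (b \<bullet> x + \<beta> + t * (p \<bullet> x + q)) < 0) \<partial>affine_lebesgue V)"
      proof (rule integral_cong_AE)
        show "AE x in affine_lebesgue V. h t x = H x * of_bool (\<sigma> * (b \<bullet> x + \<beta> + t * (p \<bullet> x + q)) < 0)"
          using AE_affine_lebesgue[OF V V0] by eventually_elim (simp add: h_def V_def)
      qed measurable
      finally show ?thesis .
    qed
    let ?m = "sgn b - (sgn b \<bullet> sgn a) *\<^sub>R sgn a"
    show ?thesis
    proof (cases "?m = 0")
      case True
      then obtain \<rho> where \<rho>: "b = \<rho> *\<^sub>R a" using conormal_slope_parallel[of b a] by auto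
      define \<kappa> where "\<kappa> = \<beta> - \<rho> * \<alpha>"
      have onV: "b \<bullet> x + \<beta> = \<kappa>" if "x \<in> V" for x
        using that by (simp add: V_def \<rho> \<kappa>_def) (metis add.commute add_uminus_conv_diff eq_neg_iff_add_eq_0 mult_minus_right)
      have "l x = 0" for x using True by (simp add: l_def conormal_slope_def)
      moreover have "eventually (\<lambda>t. integral\<^sup>L ?S1 (h t) = integral\<^sup>L ?S1 (h 0)) (at 0)"
      proof (cases "\<kappa> = 0")
        case True
        have "L = V" using onV True by (auto simp: L_def V_def)
        then have "aff_dim (K \<inter> V) \<le> int DIM('a) - 2"
          using cond by (intro affine_slice_codim2[OF d K(1) V VU]) (auto simp: L_def)
        then have "aff_dim (K \<inter> V) < aff_dim V" using dV d by (simp add: of_nat_diff)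
        then have AE: "AE x in affine_lebesgue V. x \<notin> K \<inter> V" by (rule AE_affine_lebesgue_lower_dim[OF V])
        have "integral\<^sup>L ?S1 (h t) = 0" for t
        proof -
          have "AE x in affine_lebesgue V. H x * of_bool (\<sigma> * (b \<bullet> x + \<beta> + t * (p \<bullet> x + q)) < 0) = 0"
            using AE AE_affine_lebesgue[OF V V0] by eventually_elim (use supp in auto)
          then show ?thesis unfolding Jh by (rule integral_eq_zero_AE)
        qed
        then show ?thesis by simp
      next
        case False
        have "eventually (\<lambda>t. \<bar>t\<bar> < \<bar>\<kappa>\<bar> / W) (at 0)"
          using False W(2) by (auto simp: eventually_at intro!: exI[of _ "\<bar>\<kappa>\<bar> / W"])
        then show ?thesis
        proof eventually_elim
          case (elim t)
          have "h t x = h 0 x" for x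
          proof (cases "x \<in> K \<inter> V")
            case True
            then have "\<bar>t * (p \<bullet> x + q)\<bar> \<le> \<bar>t\<bar> * W" using W(1)[of x] by (auto simp: abs_mult intro: mult_left_mono)
            also have "\<dots> < \<bar>\<kappa>\<bar>" using elim W(2) by (simp add: field_simps)
            finally have "\<bar>t * (p \<bullet> x + q)\<bar> < \<bar>\<kappa>\<bar>" .
            then have "\<sigma> * (\<kappa> + t * (p \<bullet> x + q)) < 0 \<longleftrightarrow> \<sigma> * \<kappa> < 0" using \<sigma> by auto
            then show ?thesis using onV[of x] True by (simp add: h_def)
          next
            case False
            show ?thesis using False supp[of x] by (auto simp: h_def V_def)
          qed
          then have "h t = h 0" by (rule ext)
          then show ?case by simp
        qed
      qed
      ultimately show ?thesis using hint by (intro trivial) auto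
    next
      case m0: False
      define N where "N = sgn ?m"
      note N = conormal_transversal[OF a0 m0, folded N_def]
      define c where "c = N \<bullet> b"
      have c: "c > 0" "conormal_slope a b = c" using N by (auto simp: c_def)
      have VL: "V = {y + s *\<^sub>R N |y s. y \<in> L}"
      proof (intro set_eqI iffI)
        fix x assume x: "x \<in> V"
        let ?s = "(b \<bullet> x + \<beta>) / c"
        have "x - ?s *\<^sub>R N \<in> L" using x N(2) c
          by (simp add: L_def V_def inner_diff_right inner_commute[of a N] inner_commute[of b N] c_def[symmetric])
        then show "x \<in> {y + s *\<^sub>R N |y s. y \<in> L}" by (intro CollectI exI[of _ "x - ?s *\<^sub>R N"] exI[of _ ?s]) simp
      next
        fix x assume "x \<in> {y + s *\<^sub>R N |y s. y \<in> L}"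
        then show "x \<in> V" using N(2) by (auto simp: L_def V_def inner_add_right inner_commute[of a N])
      qed
      have Lh: "L = {x. a \<bullet> x = - \<alpha>} \<inter> {x. b \<bullet> x = - \<beta>}" by (auto simp: L_def)
      have L: "affine L" unfolding Lh by (intro affine_Int affine_hyperplane)
      have L0: "L \<noteq> {}" using V0 VL by auto
      have LU: "L \<noteq> UNIV" using VU by (auto simp: L_def V_def)
      have orth: "N \<bullet> (x - y) = 0" if "x \<in> L" "y \<in> L" for x y
      proof (rule N(5))
        show "a \<bullet> (x - y) = 0" "b \<bullet> (x - y) = 0" using that by (auto simp: L_def inner_diff_right)
      qed
      have dL: "aff_dim L = int (DIM('a) - 2)"
        using affine_lebesgue_split(3)[OF L L0 N(1) orth VL] dV d by (simp add: of_nat_diff)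
      note sL [measurable_cong] = sets_affine_lebesgue[OF L L0]
      have lL: "x \<notin> L \<Longrightarrow> l x = 0" for x by (auto simp: l_def L_def)
      have lb: "\<bar>l x\<bar> \<le> M * (W / c)" for x
      proof (cases "x \<in> K")
        case True
        have "\<bar>H x * ((p \<bullet> x + q) / c)\<bar> \<le> M * (W / c)"
          unfolding abs_mult abs_divide using bound[of x] W(1)[OF True] c(1) M0
          by (intro mult_mono divide_right_mono) (auto simp: divide_right_mono)
        then show ?thesis using M0 W(2) c by (auto simp: l_def)
      next
        case False
        then show ?thesis using supp M0 W(2) c(1) by (simp add: l_def)
      qed
      have ls: "norm x \<le> r" if "l x \<noteq> 0" for x using that suppr by (auto simp: l_def)
      have lint: "integrable ?S2 l"
        by (rule iffD2[OF integrable_surface_measure_affine[OF L dL lm lL] integrable_affine_lebesgue_bounded[OF L L0 lm lb ls]])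
      have Jl: "integral\<^sup>L ?S2 l = (\<integral>x. H x * ((p \<bullet> x + q) / c) \<partial>affine_lebesgue L)"
      proof -
        have "integral\<^sup>L ?S2 l = integral\<^sup>L (affine_lebesgue L) l"
          by (rule integral_surface_measure_affine[OF L dL lm lL])
        also have "\<dots> = (\<integral>x. H x * ((p \<bullet> x + q) / c) \<partial>affine_lebesgue L)"
        proof (rule integral_cong_AE)
          show "AE x in affine_lebesgue L. l x = H x * ((p \<bullet> x + q) / c)"
            using AE_affine_lebesgue[OF L L0] by eventually_elim (simp add: l_def L_def c)
        qed measurable
        finally show ?thesis .
      qed
      have Hc: "AE y in affine_lebesgue L. isCont H y"
      proof -
        have dL': "aff_dim L = int DIM('a) - 2" using dL d by (simp add: of_nat_diff)
        have "thin (int DIM('a) - 2) (frontier K \<inter> L)"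
          using cond by (intro affine_slice_frontier_thin[OF d K L LU]) (auto simp: L_def)
        from thin_Un[OF this cont]
        have "AE y in affine_lebesgue L. y \<notin> frontier K \<inter> L \<union>
            {x \<in> interior K. a \<bullet> x + \<alpha> = 0 \<and> b \<bullet> x + \<beta> = 0 \<and> \<not> isCont H x}"
          unfolding dL'[symmetric] by (rule thin_AE_affine_lebesgue[OF L])
        then show ?thesis using AE_affine_lebesgue[OF L L0]
        proof eventually_elim
          fix y assume y: "y \<notin> frontier K \<inter> L \<union> {x \<in> interior K. a \<bullet> x + \<alpha> = 0 \<and> b \<bullet> x + \<beta> = 0 \<and> \<not> isCont H x}" "y \<in> L"
          show "isCont H y"
          proof (cases "y \<in> K")
            case True
            then have "y \<in> interior K" using y closure_subset[of K] by (auto simp: frontier_def)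
            then show ?thesis using y by (auto simp: L_def)
          next
            case False
            have "eventually (\<lambda>x. x \<in> - K) (nhds y)" using False \<open>closed K\<close> by (intro eventually_nhds_in_open) auto
            then have "eventually (\<lambda>x. H x = 0) (nhds y)" by eventually_elim (simp add: supp)
            then show ?thesis by (subst isCont_cong) auto
          qed
        qed
      qed
      \<comment> \<open>The parameter \<open>\<epsilon>\<close> covers both directions: for \<open>\<epsilon> = -1\<close> the left-sided limit is
        turned into a right-sided one for the velocity \<open>- w\<close>. The normal \<open>\<sigma> *\<^sub>R N\<close> points out
        of the half-space that is integrated over.\<close>
      have right: "((\<lambda>t. (integral\<^sup>L ?S1 (h (\<epsilon> * t)) - integral\<^sup>L ?S1 (h 0)) / t)
          \<longlongrightarrow> - (\<integral>x. H x * (\<sigma> * \<epsilon> * (p \<bullet> x + q) / c) \<partial>affine_lebesgue L)) (at_right 0)" for \<epsilon>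
      proof -
        have ss: "\<sigma> * (\<sigma> * z) = z" for z using \<sigma> by auto
        have n: "norm (\<sigma> *\<^sub>R N) = 1" using N(1) \<sigma> by auto
        have o: "(\<sigma> *\<^sub>R N) \<bullet> (x - y) = 0" if "x \<in> L" "y \<in> L" for x y using orth[OF that] by simp
        have v: "V = {y + s *\<^sub>R (\<sigma> *\<^sub>R N) |y s. y \<in> L}"
          unfolding VL
        proof (intro Collect_cong iffI; elim exE conjE)
          fix x y s assume "x = y + s *\<^sub>R N" "y \<in> L"
          then show "\<exists>y s. x = y + s *\<^sub>R \<sigma> *\<^sub>R N \<and> y \<in> L"
            using ss[of s] by (intro exI[of _ y] exI[of _ "s * \<sigma>"]) (simp add: mult.assoc mult.left_commute)
        next
          fix x y s assume "x = y + s *\<^sub>R \<sigma> *\<^sub>R N" "y \<in> L"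
          then show "\<exists>y s. x = y + s *\<^sub>R N \<and> y \<in> L" by (intro exI[of _ y] exI[of _ "s * \<sigma>"]) simp
        qed
        have f: "\<sigma> * (b \<bullet> (y + s *\<^sub>R \<sigma> *\<^sub>R N) + \<beta>) = c * s" if "y \<in> L" for y s
        proof -
          have "b \<bullet> (y + s *\<^sub>R \<sigma> *\<^sub>R N) + \<beta> = (b \<bullet> y + \<beta>) + s * (\<sigma> * c)"
            by (simp add: inner_add_right c_def inner_commute)
          also have "b \<bullet> y + \<beta> = 0" using that by (simp add: L_def)
          finally show ?thesis using ss by (simp add: algebra_simps)
        qed
        have "\<sigma> * (b \<bullet> x + \<beta>) + t * (\<sigma> * \<epsilon> * (p \<bullet> x + q)) = \<sigma> * (b \<bullet> x + \<beta> + (\<epsilon> * t) * (p \<bullet> x + q))" for x t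
          by (simp add: algebra_simps)
        note e1 = this
        have e2: "\<sigma> * (b \<bullet> x + \<beta> + 0 * (p \<bullet> x + q)) = \<sigma> * (b \<bullet> x + \<beta>)" for x by simp
        have "continuous_on UNIV (\<lambda>x. \<sigma> * \<epsilon> * (p \<bullet> x + q))" by (intro continuous_intros)
        moreover have "(\<lambda>x. \<sigma> * (b \<bullet> x + \<beta>)) \<in> borel_measurable borel" by measurable
        ultimately have "((\<lambda>t. ((\<integral>x. H x * of_bool (\<sigma> * (b \<bullet> x + \<beta>) + t * (\<sigma> * \<epsilon> * (p \<bullet> x + q)) < 0) \<partial>affine_lebesgue V)
             - (\<integral>x. H x * of_bool (\<sigma> * (b \<bullet> x + \<beta>) < 0) \<partial>affine_lebesgue V)) / t)
          \<longlongrightarrow> - (\<integral>x. H x * (\<sigma> * \<epsilon> * (p \<bullet> x + q) / c) \<partial>affine_lebesgue L)) (at_right 0)"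
          by (intro moving_halfspace_derivative[OF L L0 n o v H bound suppr Hc c(1) f])
        then show ?thesis unfolding Jh e1 e2 .
      qed
      have "((\<lambda>t. (integral\<^sup>L ?S1 (h t) - integral\<^sup>L ?S1 (h 0)) / t) \<longlongrightarrow> - \<sigma> * integral\<^sup>L ?S2 l) (at_right 0)"
      proof -
        have "H x * (\<sigma> * 1 * (p \<bullet> x + q) / c) = \<sigma> * (H x * ((p \<bullet> x + q) / c))" for x by simp
        then have "(\<integral>x. H x * (\<sigma> * 1 * (p \<bullet> x + q) / c) \<partial>affine_lebesgue L) = \<sigma> * integral\<^sup>L ?S2 l"
          unfolding Jl by (simp only: integral_mult_right_zero)
        then show ?thesis using right[of 1] by simp
      qed
      moreover have "((\<lambda>t. (integral\<^sup>L ?S1 (h t) - integral\<^sup>L ?S1 (h 0)) / t) \<longlongrightarrow> - \<sigma> * integral\<^sup>L ?S2 l) (at_left 0)"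
      proof -
        have "H x * (\<sigma> * -1 * (p \<bullet> x + q) / c) = - \<sigma> * (H x * ((p \<bullet> x + q) / c))" for x by simp
        then have "(\<integral>x. H x * (\<sigma> * -1 * (p \<bullet> x + q) / c) \<partial>affine_lebesgue L) = - \<sigma> * integral\<^sup>L ?S2 l"
          unfolding Jl by (simp only: integral_mult_right_zero)
        then have "((\<lambda>t. (integral\<^sup>L ?S1 (h (- t)) - integral\<^sup>L ?S1 (h 0)) / t) \<longlongrightarrow> \<sigma> * integral\<^sup>L ?S2 l) (at_right 0)"
          using right[of "-1"] by simp
        from tendsto_minus[OF this] show ?thesis by (simp add: filterlim_at_left_to_right)
      qed
      ultimately show ?thesis using hint lint by (auto simp: filterlim_at_split)
    qed
  qed
  show "integrable ?S1 (h t)" by (rule main[THEN conjunct1])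
  show "integrable ?S2 l" by (rule main[THEN conjunct2, THEN conjunct1])
  show "((\<lambda>t. (integral\<^sup>L ?S1 (h t) - integral\<^sup>L ?S1 (h 0)) / t) \<longlongrightarrow> - \<sigma> * integral\<^sup>L ?S2 l) (at 0)"
    by (rule main[THEN conjunct2, THEN conjunct2])
qed

section \<open>The mesh and its cells\<close>

text \<open>
  The surface measure is complete, so measurability of \<open>f\<close> follows from that of \<open>f'\<close>. This is
  how conormal derivatives and one-sided limits, which are arbitrary on the cell boundaries, become
  admissible integrands.
\<close>

lemma integral_surface_measure_cong_AE:
  fixes f f' :: "'a::euclidean_space \<Rightarrow> real"
  assumes f': "f' \<in> borel_measurable borel" and eq: "AE x in surface_measure m. f x = f' x"
  shows "integral\<^sup>L (surface_measure m) f = integral\<^sup>L (surface_measure m) f'"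
proof (rule integral_cong_AE[OF _ surface_measurable[OF f'] eq])
  interpret complete_measure "surface_measure m :: 'a measure"
    unfolding surface_measure_def ..
  show "f \<in> borel_measurable (surface_measure m)"
  proof (rule measurableI)
    fix B :: "real set" assume B: "B \<in> sets borel"
    have "AE x in surface_measure m. x \<in> f' -` B \<longleftrightarrow> x \<in> f -` B"
      using eq by eventually_elim auto
    moreover have "f' -` B \<in> sets (surface_measure m)"
      using measurable_sets[OF surface_measurable[OF f'] B, of m] by simp
    ultimately show "f -` B \<inter> space (surface_measure m) \<in> sets (surface_measure m)"
      using in_sets_AE[of "f' -` B" "f -` B"] by simp
  qed auto
qed

lemma gradient_affine:
  fixes f :: "'a::euclidean_space \<Rightarrow> real"
  assumes f: "\<And>y. y \<in> K \<Longrightarrow> f y = a \<bullet> y + \<alpha>" and x: "x \<in> interior K"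
  shows "gradient f x = a"
proof -
  have "((\<lambda>y. a \<bullet> y + \<alpha>) has_derivative (\<lambda>h. h \<bullet> a)) (at x)"
    by (auto intro!: derivative_eq_intros simp: inner_commute)
  then have d: "(f has_derivative (\<lambda>h. h \<bullet> a)) (at x)"
    by (rule has_derivative_transform_within_open[OF _ open_interior x])
      (metis f interior_subset subsetD)
  show ?thesis unfolding gradient_def
  proof (rule the_equality)
    show "GDERIV f x :> a" using d by (simp add: gderiv_def)
    fix v assume "GDERIV f x :> v"
    then have "(\<lambda>h. h \<bullet> v) = (\<lambda>h. h \<bullet> a)"
      using has_derivative_unique[OF d] by (simp add: gderiv_def)
    then have "\<forall>h. h \<bullet> v = h \<bullet> a" by (simp add: fun_eq_iff)
    then show "v = a" by (simp only: vector_eq_ldot)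
  qed
qed

lemma conormal_slope_nonneg: "conormal_slope a b \<ge> 0"
proof (cases "a = 0 \<or> sgn b - (sgn b \<bullet> sgn a) *\<^sub>R sgn a = 0")
  case True
  then show ?thesis by (auto simp: conormal_slope_def sgn_div_norm)
next
  case False
  then show ?thesis using conormal_transversal[of a b] by simp
qed

lemma conormal_deriv_eq_slope: "conormal_deriv f f' x = conormal_slope (gradient f x) (gradient f' x)"
  by (simp add: conormal_deriv_def conormal_def unit_normal_def conormal_slope_def)

lemma
  fixes T :: "'a::euclidean_space set set"
  assumes T: "mesh D T"
  shows mesh_finite: "finite T"
    and mesh_Union: "\<Union>T = D"
    and mesh_cell_polytope: "K \<in> T \<Longrightarrow> polytope K"
    and mesh_cell_dim: "K \<in> T \<Longrightarrow> aff_dim K = int DIM('a)"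
  using T unfolding mesh_def triangulation_def by (auto intro: simplex_imp_polytope)

text \<open>
  The intersection of the cells is a face of both. As it meets the interior of \<open>K\<close>, it is \<open>K\<close>
  itself. So \<open>K\<close> is a face of \<open>K'\<close>, and not a proper one since their dimensions agree.
\<close>

lemma mesh_interior_unique:
  fixes T :: "'a::euclidean_space set set"
  assumes T: "mesh D T" and K: "K \<in> T" "K' \<in> T" and x: "x \<in> interior K" "x \<in> K'"
  shows "K' = K"
proof -
  have f: "(K \<inter> K') face_of K" "(K' \<inter> K) face_of K'"
    using T K unfolding mesh_def triangulation_def by blast+
  have "rel_interior K = interior K"
    using mesh_cell_dim[OF T K(1)] by (simp add: rel_interior_interior aff_dim_eq_full)
  then have "K \<inter> K' = K" using face_of_disjoint_rel_interior[OF f(1)] x interior_subset by blast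
  then have "K face_of K'" using f(2) by (simp add: Int_commute)
  moreover have "convex K'" using mesh_cell_polytope[OF T K(2)] by (rule polytope_imp_convex)
  ultimately show ?thesis
    using face_of_aff_dim_lt[of K' K] mesh_cell_dim[OF T K(1)] mesh_cell_dim[OF T K(2)] by fastforce
qed

text \<open>
  A Borel partition of unity on the union of the cells, equal to 1 in the interior of its cell. It
  counts surface pieces on a common facet of several cells once.
\<close>

definition cell_weight :: "'a set set \<Rightarrow> 'a set \<Rightarrow> 'a \<Rightarrow> real" where
  "cell_weight T K x = indicator K x / (\<Sum>K'\<in>T. indicator K' x)"

lemma cell_weight_measurable:
  fixes T :: "'a::euclidean_space set set"
  assumes T: "mesh D T" and K: "K \<in> T"
  shows "cell_weight T K \<in> borel_measurable borel"
proof -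
  have "K' \<in> sets borel" if "K' \<in> T" for K'
    using mesh_cell_polytope[OF T that] by (auto intro: borel_closed polytope_imp_closed)
  then show ?thesis unfolding cell_weight_def[abs_def] using K
    by (intro borel_measurable_divide borel_measurable_sum borel_measurable_indicator) auto
qed

lemma cell_weight_outside: "x \<notin> K \<Longrightarrow> cell_weight T K x = 0"
  by (simp add: cell_weight_def)

lemma cell_weight_sum:
  assumes "finite T" "x \<in> \<Union>T"
  shows "(\<Sum>K\<in>T. cell_weight T K x) = 1"
proof -
  obtain K where K: "K \<in> T" "x \<in> K" using assms(2) by auto
  have "0 < (indicator K x :: real)" using K by simp
  also have "\<dots> \<le> (\<Sum>K'\<in>T. indicator K' x :: real)" using assms(1) K by (intro member_le_sum) auto
  finally show ?thesis unfolding cell_weight_def by (simp flip: sum_divide_distrib)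
qed

lemma cell_weight_interior:
  fixes T :: "'a::euclidean_space set set"
  assumes T: "mesh D T" and K: "K \<in> T" and x: "x \<in> interior K"
  shows "cell_weight T K x = 1"
proof -
  have "(\<Sum>K'\<in>T. indicator K' x :: real) = (\<Sum>K'\<in>T. if K' = K then 1 else 0)"
    using mesh_interior_unique[OF T K _ x] x interior_subset[of K]
    by (intro sum.cong) (auto simp: indicator_def)
  also have "\<dots> = 1" using K mesh_finite[OF T] by simp
  finally show ?thesis using x interior_subset[of K] by (auto simp: cell_weight_def)
qed

lemma cell_weight_le_1: "finite T \<Longrightarrow> K \<in> T \<Longrightarrow> \<bar>cell_weight T K x\<bar> \<le> 1"
  unfolding cell_weight_def using member_le_sum[of K T "\<lambda>K'. indicator K' x :: real"]
  by (auto simp: indicator_def sum_nonneg)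

lemma mem_subdomain_iff:
  "x \<in> subdomain D s \<phi> I \<longleftrightarrow> x \<in> D \<and> (\<forall>j\<in>I. if s j then \<phi> j x < 0 else \<phi> j x > 0)"
proof -
  have "x \<in> (if s j then neg_domain D (\<phi> j) else pos_domain D (\<phi> j)) \<longleftrightarrow>
      x \<in> D \<and> (if s j then \<phi> j x < 0 else \<phi> j x > 0)" for j
    by (simp add: neg_domain_def pos_domain_def)
  then show ?thesis by (cases "x \<in> D") (simp_all only: subdomain_def Int_iff INT_iff simp_thms)
qed

lemma subdomain_perturb:
  assumes k: "k \<in> I" and ss: "\<sigma> = (if s k then 1 else -1)"
  shows "subdomain D s (perturb \<phi> k w t) I = {x \<in> subdomain D s \<phi> (I - {k}). \<sigma> * (\<phi> k x + t * w x) < 0}"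
proof (rule set_eqI)
  fix x
  have "(\<forall>j\<in>I. if s j then perturb \<phi> k w t j x < 0 else perturb \<phi> k w t j x > 0) \<longleftrightarrow>
      (\<forall>j\<in>I - {k}. if s j then \<phi> j x < 0 else \<phi> j x > 0) \<and>
      (if s k then \<phi> k x + t * w x < 0 else \<phi> k x + t * w x > 0)"
    using k by (auto simp: perturb_def)
  also have "(if s k then \<phi> k x + t * w x < 0 else \<phi> k x + t * w x > 0) \<longleftrightarrow> \<sigma> * (\<phi> k x + t * w x) < 0"
    by (auto simp: ss)
  finally show "x \<in> subdomain D s (perturb \<phi> k w t) I \<longleftrightarrow>
      x \<in> {x \<in> subdomain D s \<phi> (I - {k}). \<sigma> * (\<phi> k x + t * w x) < 0}"
    by (simp add: mem_subdomain_iff)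
qed

lemma subdomain_borel:
  fixes D :: "'a::euclidean_space set"
  assumes "finite I" "closed D" and cont: "\<And>j. j \<in> I \<Longrightarrow> continuous_on D (\<phi> j)"
  shows "subdomain D s \<phi> I \<in> sets borel"
proof -
  have neg: "neg_domain D f \<in> sets borel" if f: "continuous_on D f" for f :: "'a \<Rightarrow> real"
  proof -
    have "neg_domain D f = D - {x \<in> D. 0 \<le> f x}" by (auto simp: neg_domain_def)
    moreover have "closed {x \<in> D. 0 \<le> f x}"
      using continuous_closed_preimage[OF f assms(2), of "{0..}"] by (simp add: vimage_def Int_def)
    ultimately show ?thesis using assms(2) by auto
  qed
  have pos: "pos_domain D f \<in> sets borel" if f: "continuous_on D f" for f :: "'a \<Rightarrow> real"
  proof -
    have "pos_domain D f = neg_domain D (\<lambda>x. - f x)" by (auto simp: pos_domain_def neg_domain_def)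
    then show ?thesis using neg[of "\<lambda>x. - f x"] f by (simp add: continuous_on_minus)
  qed
  have D: "D \<in> sets borel" using assms(2) by auto
  show ?thesis
  proof (cases "I = {}")
    case True
    then show ?thesis using D by (simp add: subdomain_def)
  next
    case False
    then show ?thesis unfolding subdomain_def using assms(1) neg pos cont D
      by (intro sets.Int sets.finite_INT) auto
  qed
qed

text \<open>
  Near \<open>x\<close> the level-set functions keep the strict signs they have at \<open>x\<close>, so the indicator
  is locally constant.
\<close>

lemma subdomain_indicator_isCont:
  fixes D :: "'a::euclidean_space set"
  assumes I: "finite I" and x: "x \<in> interior D" and cont: "\<And>j. j \<in> I \<Longrightarrow> continuous_on D (\<phi> j)"
    and nz: "\<And>j. j \<in> I \<Longrightarrow> \<phi> j x \<noteq> 0"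
  shows "isCont (indicator (subdomain D s \<phi> I) :: 'a \<Rightarrow> real) x"
proof -
  have D: "eventually (\<lambda>y. y \<in> D) (nhds x)"
    using eventually_nhds_in_open[OF open_interior x] by eventually_elim (use interior_subset in auto)
  have "eventually (\<lambda>y. \<forall>j\<in>I. sgn (\<phi> j y) = sgn (\<phi> j x)) (nhds x)"
  proof (rule eventually_ball_finite[OF I], rule ballI)
    fix j assume j: "j \<in> I"
    have c: "isCont (\<phi> j) x" using cont[OF j] x by (rule continuous_on_interior)
    then have l: "(\<phi> j \<longlongrightarrow> \<phi> j x) (nhds x)" by (simp add: isCont_def tendsto_at_iff_tendsto_nhds)
    show "eventually (\<lambda>y. sgn (\<phi> j y) = sgn (\<phi> j x)) (nhds x)"
    proof (cases "\<phi> j x < 0")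
      case True
      from order_tendstoD(2)[OF l True] show ?thesis by eventually_elim (use True in simp)
    next
      case False
      then have "0 < \<phi> j x" using nz[OF j] by simp
      from order_tendstoD(1)[OF l this] show ?thesis by eventually_elim (use \<open>0 < \<phi> j x\<close> in simp)
    qed
  qed
  then have "eventually (\<lambda>y. indicator (subdomain D s \<phi> I) y = (indicator (subdomain D s \<phi> I) x :: real)) (nhds x)"
    using D
  proof eventually_elim
    fix y assume *: "\<forall>j\<in>I. sgn (\<phi> j y) = sgn (\<phi> j x)" and y: "y \<in> D"
    have "(\<phi> j y < 0 \<longleftrightarrow> \<phi> j x < 0) \<and> (\<phi> j y > 0 \<longleftrightarrow> \<phi> j x > 0)" if "j \<in> I" for j
      using * that by (metis sgn_greater sgn_less)
    moreover have "x \<in> D" using x interior_subset by auto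
    ultimately have "y \<in> subdomain D s \<phi> I \<longleftrightarrow> x \<in> subdomain D s \<phi> I"
      using y by (auto simp: mem_subdomain_iff)
    then show "indicator (subdomain D s \<phi> I) y = (indicator (subdomain D s \<phi> I) x :: real)"
      by (simp add: indicator_def)
  qed
  then show ?thesis by (subst isCont_cong) auto
qed

lemma broken_C0_isCont:
  assumes g: "g \<in> broken_C0 T" and K: "K \<in> T" and x: "x \<in> interior K"
  shows "isCont g x"
proof -
  obtain h where h: "continuous_on K h" "\<And>y. y \<in> interior K \<Longrightarrow> g y = h y"
    using g K by (auto simp: broken_C0_def)
  have "isCont h x" using h(1) x by (rule continuous_on_interior)
  moreover have "eventually (\<lambda>y. g y = h y) (nhds x)"
    using eventually_nhds_in_open[OF open_interior x] by eventually_elim (rule h(2))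
  ultimately show ?thesis by (simp add: isCont_cong)
qed

section \<open>The semiderivative of the surface integral\<close>

theorem theorem3p15:
  fixes D :: "'a::euclidean_space set" and T :: "'a set set"
    and \<phi> :: "nat \<Rightarrow> 'a \<Rightarrow> real" and s :: "nat \<Rightarrow> bool" and n i k :: nat
    and w g :: "'a \<Rightarrow> real"
  assumes "DIM('a) \<ge> 2"
    and "mesh D T"
    and "\<And>j. j \<in> {1..n} \<Longrightarrow> \<phi> j \<in> V_h T"
    and "\<And>j. j \<in> {1..n} \<Longrightarrow> nondegenerate T (\<phi> j)"
    and "i \<in> {1..n}" and "k \<in> {1..n}" and "i \<noteq> k"
    and "w \<in> lagrange_basis T"
    and "g \<in> broken_C0 T"
    and "intersection_condition D T n \<phi> k"
    and "small_perturbations T (subdomain D s \<phi> ({1..n} - {i, k})) (\<phi> k) w"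
  shows
    "let \<Gamma> = level_set D (\<phi> i) \<inter> level_set D (\<phi> k) \<inter> subdomain D s \<phi> ({1..n} - {i, k});
         S = level_set D (\<phi> i) \<inter> subdomain D s \<phi> ({1..n} - {i}) \<inter> cell_interiors T;
         R = side_sign s k *
           (LINT x : \<Gamma> | surface_measure (DIM('a) - 2).
              g x * (w x / \<bar>conormal_deriv (\<phi> i) (\<phi> k) x\<bar>));
         R\<^sub>S = side_sign s k *
           (LINT x : \<Gamma> | surface_measure (DIM('a) - 2).
              value_from S g x * (w x / \<bar>value_from S (conormal_deriv (\<phi> i) (\<phi> k)) x\<bar>))
     in (diff_quotient D n s i k g \<phi> w \<longlongrightarrow> R) (at_right 0) \<and>
        (level_set D (\<phi> k) \<inter> mesh_points T \<noteq> {} \<longrightarrow>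
           (diff_quotient D n s i k g \<phi> w \<longlongrightarrow> R\<^sub>S) (at_right 0)) \<and>
        (level_set D (\<phi> k) \<inter> mesh_points T = {} \<longrightarrow>
           (diff_quotient D n s i k g \<phi> w \<longlongrightarrow> R) (at_left 0))"
proof -
  note d = assms(1) and T = assms(2) and g = assms(9)
  define I where "I = {1..n} - {i, k}"
  define G where "G = subdomain D s \<phi> I"
  define \<sigma> :: real where "\<sigma> = (if s k then 1 else -1)"
  have side: "side_sign s k = - \<sigma>" by (simp add: side_sign_def \<sigma>_def)
  have \<sigma>: "\<sigma> = 1 \<or> \<sigma> = -1" by (simp add: \<sigma>_def)
  note fin = mesh_finite[OF T] and UD = mesh_Union[OF T] and poly = mesh_cell_polytope[OF T] and dimK = mesh_cell_dim[OF T]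
  have KD: "K \<subseteq> D" if "K \<in> T" for K using that UD by auto
  have clK: "closed K" if "K \<in> T" for K using poly[OF that] by (rule polytope_imp_closed)
  have "closed D" unfolding UD[symmetric] using fin clK by (intro closed_Union) auto
  have V: "\<phi> j \<in> V_h T" if "j \<in> {1..n}" for j using assms(3)[OF that] .
  have contD: "continuous_on D (\<phi> j)" if "j \<in> {1..n}" for j using V[OF that] UD by (simp add: V_h_def)
  have "\<exists>a. \<forall>K\<in>T. \<forall>x\<in>K. v x = fst (a K) \<bullet> x + snd (a K)" if "v \<in> V_h T" for v
  proof -
    have "\<forall>K\<in>T. \<exists>a. \<forall>x\<in>K. v x = fst a \<bullet> x + snd a" using that by (auto simp: V_h_def)
    then show ?thesis by (rule bchoice)
  qed
  note aff = this
  obtain A where A: "\<And>K x. K \<in> T \<Longrightarrow> x \<in> K \<Longrightarrow> \<phi> i x = fst (A K) \<bullet> x + snd (A K)"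
    using aff[OF V[OF assms(5)]] by auto
  obtain B where B: "\<And>K x. K \<in> T \<Longrightarrow> x \<in> K \<Longrightarrow> \<phi> k x = fst (B K) \<bullet> x + snd (B K)"
    using aff[OF V[OF assms(6)]] by auto
  obtain P where P: "\<And>K x. K \<in> T \<Longrightarrow> x \<in> K \<Longrightarrow> w x = fst (P K) \<bullet> x + snd (P K)"
    using aff[of w] assms(8) by (auto simp: lagrange_basis_def)
  define Z where "Z K = {x. fst (A K) \<bullet> x + snd (A K) = 0 \<and> fst (B K) \<bullet> x + snd (B K) = 0}" for K
  have Zaff: "affine (Z K)" for K
  proof -
    have "Z K = {x. fst (A K) \<bullet> x = - snd (A K)} \<inter> {x. fst (B K) \<bullet> x = - snd (B K)}"
      by (auto simp: Z_def)
    then show ?thesis by (simp add: affine_Int affine_hyperplane)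
  qed
  have nondeg: "\<exists>x\<in>K. fst (A K) \<bullet> x + snd (A K) \<noteq> 0" if "K \<in> T" for K
    using assms(4)[OF assms(5)] that A by (auto simp: nondegenerate_def)
  have ZU: "Z K \<noteq> UNIV" if "K \<in> T" for K using nondeg[OF that] by (auto simp: Z_def)
  have Zlev: "x \<in> Z K \<longleftrightarrow> \<phi> i x = 0 \<and> \<phi> k x = 0" if "K \<in> T" "x \<in> K" for K x
    using that A B by (simp add: Z_def)
  have cond: "\<not> S \<subseteq> frontier K" "\<And>j. j \<in> I \<Longrightarrow> \<not> (\<forall>x\<in>S. \<phi> j x = 0)"
    if S: "convex S" "aff_dim S = int DIM('a) - 2" "S \<subseteq> K \<inter> Z K" "K \<in> T" for S K
  proof -
    have lev: "S \<subseteq> level_set D (\<phi> i)" "S \<subseteq> level_set D (\<phi> k)"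
      using S(3) Zlev[OF S(4)] KD[OF S(4)] by (auto simp: level_set_def)
    have ic: "card {j \<in> {1..n} - {k}. S \<subseteq> level_set D (\<phi> j)} \<le> 1"
      "\<forall>j \<in> {1..n} - {k}. S \<subseteq> level_set D (\<phi> j) \<longrightarrow> (\<forall>K\<in>T. \<not> S \<subseteq> frontier K)"
      using assms(10) S(1,2) lev(2) unfolding intersection_condition_def by blast+
    show "\<not> S \<subseteq> frontier K" using ic(2) lev(1) assms(5,7) S(4) by auto
    show "\<not> (\<forall>x\<in>S. \<phi> j x = 0)" if j: "j \<in> I" for j
    proof
      assume "\<forall>x\<in>S. \<phi> j x = 0"
      then have "S \<subseteq> level_set D (\<phi> j)" using S(3) KD[OF S(4)] by (auto simp: level_set_def)
      \<comment> \<open>Two zero sets besides that of \<open>\<phi> k\<close> would contain \<open>S\<close>.\<close>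
      then have "{i, j} \<subseteq> {j \<in> {1..n} - {k}. S \<subseteq> level_set D (\<phi> j)}"
        using lev(1) j assms(5,7) by (auto simp: I_def)
      then have "card {i, j} \<le> card {j \<in> {1..n} - {k}. S \<subseteq> level_set D (\<phi> j)}" by (intro card_mono) auto
      moreover have "card {i, j} = 2" using j by (auto simp: I_def)
      ultimately show False using ic(1) by simp
    qed
  qed
  have frontier_thin: "thin (int DIM('a) - 2) (frontier K \<inter> Z K)" if K: "K \<in> T" for K
    by (rule affine_slice_frontier_thin[OF d poly[OF K] dimK[OF K] Zaff ZU[OF K]]) (rule cond(1)[OF _ _ _ K])
  have triple_thin: "thin (int DIM('a) - 2) {x \<in> K \<inter> Z K. \<phi> j x = 0}" if K: "K \<in> T" and j: "j \<in> I" for K j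
  proof (rule thin_lower_dim)
    obtain a where a: "\<And>x. x \<in> K \<Longrightarrow> \<phi> j x = fst a \<bullet> x + snd a"
      using aff[OF V, of j] K j by (auto simp: I_def)
    let ?S = "{x \<in> K \<inter> Z K. \<phi> j x = 0}"
    have "?S = K \<inter> (Z K \<inter> {x. fst a \<bullet> x = - snd a})" using a by auto
    then have "convex ?S"
      using polytope_imp_convex[OF poly[OF K]] Zaff[of K]
      by (simp add: convex_Int affine_imp_convex affine_hyperplane)
    then have "aff_dim ?S \<noteq> int DIM('a) - 2" using cond(2)[of ?S K j] K j by auto
    moreover have "aff_dim ?S \<le> aff_dim (K \<inter> Z K)" by (intro aff_dim_subset) auto
    moreover have "aff_dim (K \<inter> Z K) \<le> int DIM('a) - 2"
      by (rule affine_slice_codim2[OF d poly[OF K] Zaff ZU[OF K]]) (rule cond(1)[OF _ _ _ K])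
    ultimately show "aff_dim ?S < int DIM('a) - 2" by simp
  qed
  have Gb: "G \<in> sets borel" unfolding G_def using contD \<open>closed D\<close>
    by (intro subdomain_borel) (auto simp: I_def)
  obtain M where M: "\<And>x. x \<in> D \<Longrightarrow> \<bar>g x\<bar> \<le> M" "M > 0"
  proof -
    have "bounded (g ` D)" using g UD by (auto simp: broken_C0_def)
    then show thesis using that unfolding bounded_pos by auto
  qed
  have gb: "(\<lambda>x. indicator D x * g x) \<in> borel_measurable borel"
    using g UD by (simp add: broken_C0_def set_borel_measurable_def)
  define H where "H K x = cell_weight T K x * (indicator D x * g x) * indicator G x" for K x
  have Hm: "H K \<in> borel_measurable borel" if "K \<in> T" for K
    unfolding H_def[abs_def] using cell_weight_measurable[OF T that] gb Gb by measurable
  have Hb: "\<bar>H K x\<bar> \<le> M" if "K \<in> T" for K x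
  proof -
    have "\<bar>H K x\<bar> = \<bar>cell_weight T K x\<bar> * \<bar>indicator D x * g x\<bar> * indicator G x"
      by (simp add: H_def abs_mult)
    also have "\<dots> \<le> 1 * M * 1"
      using cell_weight_le_1[OF fin that] M by (intro mult_mono) (auto simp: indicator_def)
    finally show ?thesis by simp
  qed
  have Hs: "H K x = 0" if "x \<notin> K" for K x using cell_weight_outside[OF that] by (simp add: H_def)
  have Hi: "H K x = g x * indicator G x" if "K \<in> T" "x \<in> interior K" for K x
    using cell_weight_interior[OF T that] KD[OF that(1)] that(2) interior_subset[of K] by (auto simp: H_def)
  have Hthin: "thin (int DIM('a) - 2) {x \<in> interior K. fst (A K) \<bullet> x + snd (A K) = 0 \<and> fst (B K) \<bullet> x + snd (B K) = 0 \<and> \<not> isCont (H K) x}"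
    if K: "K \<in> T" for K
  proof (rule thin_subset)
    show "thin (int DIM('a) - 2) (\<Union>j\<in>I. {x \<in> K \<inter> Z K. \<phi> j x = 0})"
      using triple_thin[OF K] by (intro thin_UN) (auto simp: I_def)
    show "{x \<in> interior K. fst (A K) \<bullet> x + snd (A K) = 0 \<and> fst (B K) \<bullet> x + snd (B K) = 0 \<and> \<not> isCont (H K) x}
        \<subseteq> (\<Union>j\<in>I. {x \<in> K \<inter> Z K. \<phi> j x = 0})"
    proof
      fix x assume x: "x \<in> {x \<in> interior K. fst (A K) \<bullet> x + snd (A K) = 0 \<and> fst (B K) \<bullet> x + snd (B K) = 0 \<and> \<not> isCont (H K) x}"
      have "\<exists>j\<in>I. \<phi> j x = 0"
      proof (rule ccontr)
        assume "\<not> ?thesis"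
        moreover have "x \<in> interior D" using x interior_mono[OF KD[OF K]] by auto
        ultimately have "isCont (indicator G :: 'a \<Rightarrow> real) x"
          unfolding G_def using contD by (intro subdomain_indicator_isCont) (auto simp: I_def)
        moreover have "isCont g x" using broken_C0_isCont[OF g K] x by auto
        ultimately have "isCont (\<lambda>y. g y * indicator G y) x" by (intro continuous_mult)
        moreover have "eventually (\<lambda>y. H K y = g y * indicator G y) (nhds x)"
          using eventually_nhds_in_open[OF open_interior, of x K] x by (auto elim!: eventually_mono simp: Hi[OF K])
        ultimately have "isCont (H K) x" by (simp add: isCont_cong)
        then show False using x by auto
      qed
      then show "x \<in> (\<Union>j\<in>I. {x \<in> K \<inter> Z K. \<phi> j x = 0})"
        using x interior_subset[of K] by (auto simp: Z_def)
    qed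
  qed
  let ?S1 = "surface_measure (DIM('a) - 1) :: 'a measure" and ?S2 = "surface_measure (DIM('a) - 2) :: 'a measure"
  define h where "h K t x = H K x * of_bool (fst (A K) \<bullet> x + snd (A K) = 0)
      * of_bool (\<sigma> * (fst (B K) \<bullet> x + snd (B K) + t * (fst (P K) \<bullet> x + snd (P K))) < 0)" for K t x
  define l where "l K x = H K x * of_bool (fst (A K) \<bullet> x + snd (A K) = 0) * of_bool (fst (B K) \<bullet> x + snd (B K) = 0)
      * ((fst (P K) \<bullet> x + snd (P K)) / conormal_slope (fst (A K)) (fst (B K)))" for K x
  have cond': "\<not> S \<subseteq> frontier K" if "K \<in> T" "convex S" "aff_dim S = int DIM('a) - 2"
    "S \<subseteq> K \<inter> {x. fst (A K) \<bullet> x + snd (A K) = 0 \<and> fst (B K) \<bullet> x + snd (B K) = 0}" for K S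
    using cond(1)[of S K] that by (simp add: Z_def)
  have hint: "integrable ?S1 (h K t)" if K: "K \<in> T" for K t
    unfolding h_def[abs_def]
    by (rule cell_semiderivative(1)[OF d poly[OF K] dimK[OF K] nondeg[OF K] cond'[OF K] Hm[OF K] Hb[OF K] Hs Hthin[OF K] \<sigma>])
  have lint: "integrable ?S2 (l K)" if K: "K \<in> T" for K
    unfolding l_def[abs_def]
    by (rule cell_semiderivative(2)[OF d poly[OF K] dimK[OF K] nondeg[OF K] cond'[OF K] Hm[OF K] Hb[OF K] Hs Hthin[OF K] \<sigma>])
  have hlim: "((\<lambda>t. (integral\<^sup>L ?S1 (h K t) - integral\<^sup>L ?S1 (h K 0)) / t) \<longlongrightarrow> - \<sigma> * integral\<^sup>L ?S2 (l K)) (at 0)" if K: "K \<in> T" for K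
    unfolding h_def[abs_def] l_def[abs_def]
    by (rule cell_semiderivative(3)[OF d poly[OF K] dimK[OF K] nondeg[OF K] cond'[OF K] Hm[OF K] Hb[OF K] Hs Hthin[OF K] \<sigma>])
  have J: "J D n s i g (perturb \<phi> k w t) = (\<Sum>K\<in>T. integral\<^sup>L ?S1 (h K t))" for t
  proof -
    let ?A = "level_set D (\<phi> i) \<inter> {x \<in> G. \<sigma> * (\<phi> k x + t * w x) < 0}"
    have I': "{1..n} - {i} - {k} = I" by (auto simp: I_def)
    have k: "k \<in> {1..n} - {i}" using assms(6,7) by simp
    have "subdomain D s (perturb \<phi> k w t) ({1..n} - {i}) = {x \<in> G. \<sigma> * (\<phi> k x + t * w x) < 0}"
      using subdomain_perturb[where \<phi>=\<phi> and D=D and w=w and t=t and s=s and k=k, OF k \<sigma>_def] unfolding I' G_def .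
    moreover have "perturb \<phi> k w t i = \<phi> i" using assms(7) by (simp add: perturb_def)
    ultimately have sets: "level_set D (perturb \<phi> k w t i) \<inter> subdomain D s (perturb \<phi> k w t) ({1..n} - {i}) = ?A"
      by (simp only:)
    have pt: "indicator ?A x * g x = (\<Sum>K\<in>T. h K t x)" for x
    proof (cases "x \<in> D")
      case True
      have "h K t x = cell_weight T K x * (indicator ?A x * g x)" if K: "K \<in> T" for K
      proof (cases "x \<in> K")
        case xK: True
        show ?thesis
          using True A[OF K xK] B[OF K xK] P[OF K xK] by (auto simp: h_def H_def level_set_def indicator_def)
      next
        case False
        then show ?thesis by (simp add: h_def Hs cell_weight_outside)
      qed
      then have "(\<Sum>K\<in>T. h K t x) = (\<Sum>K\<in>T. cell_weight T K x) * (indicator ?A x * g x)"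
        by (simp add: sum_distrib_right)
      then show ?thesis using cell_weight_sum[OF fin] True UD by simp
    next
      case False
      then have "h K t x = 0" if "K \<in> T" for K using KD[OF that] by (auto simp: h_def intro: Hs)
      then show ?thesis using False by (simp add: level_set_def)
    qed
    have "J D n s i g (perturb \<phi> k w t) = (\<integral>x. (\<Sum>K\<in>T. h K t x) \<partial>?S1)"
      unfolding J_def sets set_lebesgue_integral_def by (simp add: pt)
    also have "\<dots> = (\<Sum>K\<in>T. integral\<^sup>L ?S1 (h K t))" by (rule Bochner_Integration.integral_sum) (rule hint)
    finally show ?thesis .
  qed
  have "perturb \<phi> k w 0 = \<phi>" by (simp add: perturb_def)
  then have J0: "J D n s i g \<phi> = (\<Sum>K\<in>T. integral\<^sup>L ?S1 (h K 0))" using J[of 0] by simp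
  have lim: "(diff_quotient D n s i k g \<phi> w \<longlongrightarrow> - \<sigma> * (\<Sum>K\<in>T. integral\<^sup>L ?S2 (l K))) (at 0)"
  proof -
    have "diff_quotient D n s i k g \<phi> w = (\<lambda>t. \<Sum>K\<in>T. (integral\<^sup>L ?S1 (h K t) - integral\<^sup>L ?S1 (h K 0)) / t)"
      by (auto simp: diff_quotient_def J J0 fun_eq_iff sum_subtractf sum_divide_distrib[symmetric])
    then show ?thesis using tendsto_sum[OF hlim] by (simp add: sum_distrib_left)
  qed
  \<comment> \<open>Any integrand with the values of the formula inside the cells has the same integral, since the
    domain of integration meets the cell boundaries in a null set. This serves both the plain and
    the one-sided version.\<close>
  let ?\<Gamma> = "level_set D (\<phi> i) \<inter> level_set D (\<phi> k) \<inter> G"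
  have boundary_integral: "(LINT x : ?\<Gamma> | ?S2. f x) = (\<Sum>K\<in>T. integral\<^sup>L ?S2 (l K))"
    if f: "\<And>K x. K \<in> T \<Longrightarrow> x \<in> interior K \<Longrightarrow> f x = g x * (w x / \<bar>conormal_deriv (\<phi> i) (\<phi> k) x\<bar>)" for f
  proof -
    have lm: "(\<lambda>x. \<Sum>K\<in>T. l K x) \<in> borel_measurable borel"
    proof (rule borel_measurable_sum)
      fix K assume "K \<in> T"
      then have [measurable]: "H K \<in> borel_measurable borel" by (rule Hm)
      show "l K \<in> borel_measurable borel" unfolding l_def[abs_def] by measurable
    qed
    have "thin (int (DIM('a) - 2)) (\<Union>K\<in>T. frontier K \<inter> Z K)"
      using frontier_thin fin d by (intro thin_UN) (auto simp: of_nat_diff)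
    then have "AE x in ?S2. x \<notin> (\<Union>K\<in>T. frontier K \<inter> Z K)" by (rule thin_AE_surface_measure)
    then have "AE x in ?S2. indicator ?\<Gamma> x * f x = (\<Sum>K\<in>T. l K x)"
    proof eventually_elim
      fix x assume x: "x \<notin> (\<Union>K\<in>T. frontier K \<inter> Z K)"
      show "indicator ?\<Gamma> x * f x = (\<Sum>K\<in>T. l K x)"
      proof (cases "x \<in> ?\<Gamma>")
        case True
        then have "x \<in> D" by (auto simp: level_set_def)
        then obtain K where K: "K \<in> T" "x \<in> K" using UD by auto
        have xZ: "x \<in> Z K" using True Zlev[OF K] by (auto simp: level_set_def)
        then have xi: "x \<in> interior K" using x K closure_subset[of K] by (auto simp: frontier_def)
        have grad: "gradient (\<phi> i) x = fst (A K)" "gradient (\<phi> k) x = fst (B K)"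
          using gradient_affine[OF A[OF K(1)] xi] gradient_affine[OF B[OF K(1)] xi] by auto
        have other: "l K' x = 0" if "K' \<in> T - {K}" for K'
          using that mesh_interior_unique[OF T K(1) _ xi, of K'] by (auto simp: l_def intro: Hs)
        have "(\<Sum>K'\<in>T. l K' x) = l K x" using K(1) fin other by (simp add: sum.remove)
        also have "\<dots> = g x * (w x / \<bar>conormal_deriv (\<phi> i) (\<phi> k) x\<bar>)"
          using xZ Hi[OF K(1) xi] True P[OF K] conormal_slope_nonneg[of "fst (A K)" "fst (B K)"]
          by (simp add: l_def Z_def conormal_deriv_eq_slope grad)
        finally show ?thesis using True f[OF K(1) xi] by simp
      next
        case False
        have "l K x = 0" if K: "K \<in> T" for K
        proof (cases "x \<in> K")
          case True
          then show ?thesis using False A[OF K] B[OF K] KD[OF K] by (auto simp: l_def H_def level_set_def)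
        qed (simp add: l_def Hs)
        then show ?thesis using False by simp
      qed
    qed
    then have "(LINT x : ?\<Gamma> | ?S2. f x) = (\<integral>x. (\<Sum>K\<in>T. l K x) \<partial>?S2)"
      unfolding set_lebesgue_integral_def by (intro integral_surface_measure_cong_AE lm) simp
    also have "\<dots> = (\<Sum>K\<in>T. integral\<^sup>L ?S2 (l K))" by (rule Bochner_Integration.integral_sum) (rule lint)
    finally show ?thesis .
  qed
  have cd: "isCont (conormal_deriv (\<phi> i) (\<phi> k)) x" if K: "K \<in> T" and x: "x \<in> interior K" for K x
  proof -
    have "eventually (\<lambda>y. conormal_deriv (\<phi> i) (\<phi> k) y = conormal_slope (fst (A K)) (fst (B K))) (nhds x)"
      using eventually_nhds_in_open[OF open_interior x]
    proof eventually_elim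
      fix y assume y: "y \<in> interior K"
      show "conormal_deriv (\<phi> i) (\<phi> k) y = conormal_slope (fst (A K)) (fst (B K))"
        using gradient_affine[OF A[OF K] y] gradient_affine[OF B[OF K] y] by (simp add: conormal_deriv_eq_slope)
    qed
    then show ?thesis by (subst isCont_cong) auto
  qed
  let ?R = "side_sign s k * (LINT x : ?\<Gamma> | ?S2. g x * (w x / \<bar>conormal_deriv (\<phi> i) (\<phi> k) x\<bar>))"
  have R: "?R = - \<sigma> * (\<Sum>K\<in>T. integral\<^sup>L ?S2 (l K))" by (simp add: side boundary_integral)
  let ?RS = "\<lambda>S. side_sign s k * (LINT x : ?\<Gamma> | ?S2. value_from S g x * (w x / \<bar>value_from S (conormal_deriv (\<phi> i) (\<phi> k)) x\<bar>))"
  have RS: "?RS S = - \<sigma> * (\<Sum>K\<in>T. integral\<^sup>L ?S2 (l K))" for S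
    unfolding side using cd broken_C0_isCont[OF g] by (subst boundary_integral) (auto simp: value_from_def)
  have "(diff_quotient D n s i k g \<phi> w \<longlongrightarrow> ?R) (at_right 0)" "(diff_quotient D n s i k g \<phi> w \<longlongrightarrow> ?R) (at_left 0)"
    "(diff_quotient D n s i k g \<phi> w \<longlongrightarrow> ?RS S) (at_right 0)" for S
    unfolding R RS using lim by (auto simp: filterlim_at_split)
  then show ?thesis unfolding Let_def G_def I_def by blast
qed

end
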